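(* Let $R\ge T\ge 1$ be integers and let $\mathbf{P}=(P_{r,t})\in\mathbb{R}^{R\times T}$ be a matrix with nonnegative entries having no all-zero row and no all-zero column. For $\boldsymbol{\alpha}\in\mathbb{R}_+^R$ and $\boldsymbol{\beta}\in\mathbb{R}_+^T$, set $$J(\boldsymbol{\alpha},\boldsymbol{\beta})=-RT+\sum_{r=1}^{R}\sum_{t=1}^{T}\left[\frac{P_{r,t}}{\alpha_r\beta_t}-\ln\left(\frac{P_{r,t}}{\alpha_r\beta_t}\right)\right].$$ Consider the following algorithm with tolerance $\epsilon>0$. Initialize $J^{(0)}=\infty$, $\boldsymbol{\alpha}^{(0)}=\mathbf{1}_R$, $\boldsymbol{\beta}^{(0)}=\frac1R\mathbf{P}^{\top}(\boldsymbol{\alpha}^{(0)})^{\circ-1}$. For $\kappa=1,2,\dots$ compute $$\boldsymbol{\alpha}^{(\kappa)}=\frac1T\mathbf{P}\,(\boldsymbol{\beta}^{(\kappa-1)})^{\circ-1},\qquad \boldsymbol{\beta}^{(\kappa)}=\frac1R\mathbf{P}^{\top}(\boldsymbol{\alpha}^{(\kappa)})^{\circ-1},\qquad J^{(\kappa)}=J(\boldsymbol{\alpha}^{(\kappa)},\boldsymbol{\beta}^{(\kappa)}),$$ until $|J^{(\kappa-1)}-J^{(\kappa)}|<\epsilon$; then output $\boldsymbol{\alpha}^{(\kappa)}(\boldsymbol{\beta}^{(\kappa)})^{\top}$. Then: (i) The updates for $\boldsymbol{\alpha}^{(\kappa)}$ and $\boldsymbol{\beta}^{(\kappa)}$ are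 the solutions of $\frac{\partial}{\partial\alpha_r}J(\boldsymbol{\alpha},\boldsymbol{\beta}^{(\kappa-1)})=0$ for all $r$ and of $\frac{\partial}{\partial\beta_t}J(\boldsymbol{\alpha}^{(\kappa)},\boldsymbol{\beta})=0$ for all $t$, respectively, and $$J(\boldsymbol{\alpha}^{(\kappa)},\boldsymbol{\beta}^{(\kappa)})\le J(\boldsymbol{\alpha}^{(\kappa)},\boldsymbol{\beta}^{(\kappa-1)})\le J(\boldsymbol{\alpha}^{(\kappa-1)},\boldsymbol{\beta}^{(\kappa-1)}),$$ so the objective decreases monotonically; each iteration costs $O(RT)$ operations. (ii) $J\ge 0$, and the algorithm is guaranteed to converge to a stationary point of $J$. (iii) $J$ is jointly convex in $(\mathbf{x},\mathbf{y})=(\ln\boldsymbol{\alpha},\ln\boldsymbol{\beta})$ (entrywise logarithms), so every stationary point is globally optimal. Hence the algorithm converges to the globally optimal rank-$1$ approximation $\boldsymbol{\alpha}^{\star}(\boldsymbol{\beta}^{\star})^{\top}$ of $\mathbf{P}$ under the Kullback–Leibler divergence criterion, that is, to the minimizer of $J$; and the optimal value $J^\star=J(\boldsymbol{\alpha}^\star,\boldsymbol{\beta}^\star)$ equals $0$ if and only if $\mathbf{P}$ already has rank $1$.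
   Context: $\mathbf{1}_R$ is the all-ones vector in $\mathbb{R}^R$, $\mathbf{x}^{\circ-1}$ is the entrywise inverse of a vector, and $(\cdot)^{\top}$ is the transpose. $\mathbf{P}$ is the power coupling matrix of a Weichselberger MIMO channel $\mathbf{H}=\mathbf{U}_R[\mathbf{P}^{\circ 1/2}\odot\mathbf{G}]\mathbf{U}_T^{*}$, where $\mathbf{U}_R,\mathbf{U}_T$ are deterministic unitary matrices, $\mathbf{G}$ is an $R\times T$ matrix of i.i.d. zero-mean unit-variance complex Gaussians, $\odot$ and $(\cdot)^{\circ 1/2}$ are the entrywise product and square root, and $^{*}$ is the conjugate transpose. The Kullback–Leibler criterion is to minimize over $\boldsymbol{\alpha},\boldsymbol{\beta}$ the divergence of $\mathbf{H}$ from the separable channel $\widetilde{\mathbf{H}}=\mathbf{U}_R[(\boldsymbol{\alpha}\boldsymbol{\beta}^{\top})^{\circ 1/2}\odot\widetilde{\mathbf{G}}]\mathbf{U}_T^{*}$, with $\widetilde{\mathbf{G}}$ distributed as $\mathbf{G}$. The objective of this problem is $J$, so the problem is rank-$1$ nonnegative matrix factorization of $\mathbf{P}$ under the Itakura–Saito divergence.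
   Formalization: If P has a zero entry, J is infinite everywhere, so it has no partial derivatives or stationary points and the stopping test is undefined; the claims on zeros of the partial derivatives of J, on stopping and on convergence are therefore stated for P with all entries positive. *)

theory Defs
  imports "HOL-Analysis.Analysis"
begin

text \<open>An \<open>R \<times> T\<close> matrix is a \<^typ>\<open>real ^ 't ^ 'r\<close> with \<open>R = CARD('r)\<close> and \<open>T = CARD('t)\<close>.\<close>

subsection \<open>The objective\<close>

text \<open>The natural logarithm with \<open>ln 0 = - \<infinity>\<close>. The library has \<open>ln 0 = 0\<close> on the reals, which would
  silently drop the zero entries of the matrix from the objective.\<close>

definition eln :: "real \<Rightarrow> ereal" where
  "eln u = (if 0 < u then ereal (ln u) else - \<infinity>)"

text \<open>The value is \<open>\<infinity>\<close> as soon as some \<open>P $ r $ t\<close>, \<open>\<alpha> $ r\<close> or \<open>\<beta> $ t\<close> is \<open>0\<close>. For a zero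
  denominator this uses the convention \<open>x / 0 = 0\<close>, and the value agrees with the limit.\<close>

definition J :: "real ^ 't ^ 'r \<Rightarrow> real ^ 'r \<Rightarrow> real ^ 't \<Rightarrow> ereal" where
  "J P \<alpha> \<beta> = - ereal (real CARD('r) * real CARD('t)) +
     (\<Sum>r\<in>UNIV. \<Sum>t\<in>UNIV. ereal (P $ r $ t / (\<alpha> $ r * \<beta> $ t)) - eln (P $ r $ t / (\<alpha> $ r * \<beta> $ t)))"

text \<open>\<open>J\<close> without the summands \<open>- R T - (\<Sum>r. \<Sum>t. ln (P $ r $ t))\<close>, which do not depend on
  \<open>(\<alpha>, \<beta>)\<close>. It stays finite, and so has partial derivatives, when \<open>P\<close> has zero entries.\<close>

definition J_var :: "real ^ 't ^ 'r \<Rightarrow> real ^ 'r \<Rightarrow> real ^ 't \<Rightarrow> real" where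
  "J_var P \<alpha> \<beta> = (\<Sum>r\<in>UNIV. \<Sum>t\<in>UNIV. P $ r $ t / (\<alpha> $ r * \<beta> $ t) + ln (\<alpha> $ r * \<beta> $ t))"

definition pos_vec :: "real ^ 'n \<Rightarrow> bool" where
  "pos_vec v \<longleftrightarrow> (\<forall>i. 0 < v $ i)"

definition nonneg_vec :: "real ^ 'n \<Rightarrow> bool" where
  "nonneg_vec v \<longleftrightarrow> (\<forall>i. 0 \<le> v $ i)"

definition vec_inverse :: "real ^ 'n \<Rightarrow> real ^ 'n" where
  "vec_inverse v = (\<chi> i. inverse (v $ i))"

definition vec_exp :: "real ^ 'n \<Rightarrow> real ^ 'n" where
  "vec_exp v = (\<chi> i. exp (v $ i))"

definition outer :: "real ^ 'r \<Rightarrow> real ^ 't \<Rightarrow> real ^ 't ^ 'r" where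
  "outer \<alpha> \<beta> = (\<chi> r t. \<alpha> $ r * \<beta> $ t)"

lemma J_eq_J_var:
  fixes P :: "real ^ 't ^ 'r"
  assumes P: "\<And>r t. 0 < P $ r $ t" and "pos_vec \<alpha>" "pos_vec \<beta>"
  shows "J P \<alpha> \<beta> = ereal (J_var P \<alpha> \<beta> - real CARD('r) * real CARD('t)
    - (\<Sum>r\<in>UNIV. \<Sum>t\<in>UNIV. ln (P $ r $ t)))"
proof -
  have a: "0 < \<alpha> $ r" and b: "0 < \<beta> $ t" for r t
    using assms by (auto simp: pos_vec_def)
  have "ereal (P $ r $ t / (\<alpha> $ r * \<beta> $ t)) - eln (P $ r $ t / (\<alpha> $ r * \<beta> $ t))
      = ereal (P $ r $ t / (\<alpha> $ r * \<beta> $ t) + ln (\<alpha> $ r * \<beta> $ t) - ln (P $ r $ t))" for r t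
    using a[of r] b[of t] P[of r t] mult_pos_pos[OF a[of r] b[of t]]
    by (simp add: eln_def ln_div)
  then show ?thesis
    unfolding J_def J_var_def by (simp add: sum.distrib sum_subtractf)
qed

subsection \<open>Partial derivatives, stationary points, convexity\<close>

definition vec_upd :: "real ^ 'n \<Rightarrow> 'n \<Rightarrow> real \<Rightarrow> real ^ 'n" where
  "vec_upd v i a = (\<chi> j. if j = i then a else v $ j)"

text \<open>An extended-real-valued function has a derivative only where it is finite nearby.\<close>

definition has_ereal_derivative :: "(real \<Rightarrow> ereal) \<Rightarrow> real \<Rightarrow> real \<Rightarrow> bool" where
  "has_ereal_derivative f D x \<longleftrightarrow>
     (\<exists>g. (\<forall>\<^sub>F a in nhds x. f a = ereal (g a)) \<and> (g has_real_derivative D) (at x))"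

definition stationary_in_alpha :: "real ^ 't ^ 'r \<Rightarrow> real ^ 'r \<Rightarrow> real ^ 't \<Rightarrow> bool" where
  "stationary_in_alpha P \<alpha> \<beta> \<longleftrightarrow>
     (\<forall>r. has_ereal_derivative (\<lambda>a. J P (vec_upd \<alpha> r a) \<beta>) 0 (\<alpha> $ r))"

definition stationary_in_beta :: "real ^ 't ^ 'r \<Rightarrow> real ^ 'r \<Rightarrow> real ^ 't \<Rightarrow> bool" where
  "stationary_in_beta P \<alpha> \<beta> \<longleftrightarrow>
     (\<forall>t. has_ereal_derivative (\<lambda>b. J P \<alpha> (vec_upd \<beta> t b)) 0 (\<beta> $ t))"

definition stationary_point :: "real ^ 't ^ 'r \<Rightarrow> real ^ 'r \<Rightarrow> real ^ 't \<Rightarrow> bool" where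
  "stationary_point P \<alpha> \<beta> \<longleftrightarrow>
     pos_vec \<alpha> \<and> pos_vec \<beta> \<and> stationary_in_alpha P \<alpha> \<beta> \<and> stationary_in_beta P \<alpha> \<beta>"

definition var_stationary_in_alpha :: "real ^ 't ^ 'r \<Rightarrow> real ^ 'r \<Rightarrow> real ^ 't \<Rightarrow> bool" where
  "var_stationary_in_alpha P \<alpha> \<beta> \<longleftrightarrow>
     (\<forall>r. ((\<lambda>a. J_var P (vec_upd \<alpha> r a) \<beta>) has_real_derivative 0) (at (\<alpha> $ r)))"

definition var_stationary_in_beta :: "real ^ 't ^ 'r \<Rightarrow> real ^ 'r \<Rightarrow> real ^ 't \<Rightarrow> bool" where
  "var_stationary_in_beta P \<alpha> \<beta> \<longleftrightarrow>
     (\<forall>t. ((\<lambda>b. J_var P \<alpha> (vec_upd \<beta> t b)) has_real_derivative 0) (at (\<beta> $ t)))"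

text \<open>Meant for functions that never take the value \<open>- \<infinity>\<close>; note \<open>0 * \<infinity> = 0\<close>.\<close>

definition ereal_convex :: "('a::real_vector \<Rightarrow> ereal) \<Rightarrow> bool" where
  "ereal_convex f \<longleftrightarrow> (\<forall>z w. \<forall>\<theta>\<in>{0..1}.
     f ((1 - \<theta>) *\<^sub>R z + \<theta> *\<^sub>R w) \<le> ereal (1 - \<theta>) * f z + ereal \<theta> * f w)"

definition global_minimizer :: "real ^ 't ^ 'r \<Rightarrow> real ^ 'r \<Rightarrow> real ^ 't \<Rightarrow> bool" where
  "global_minimizer P \<alpha> \<beta> \<longleftrightarrow> nonneg_vec \<alpha> \<and> nonneg_vec \<beta> \<and>
     (\<forall>\<alpha>' \<beta>'. nonneg_vec \<alpha>' \<longrightarrow> nonneg_vec \<beta>' \<longrightarrow> J P \<alpha> \<beta> \<le> J P \<alpha>' \<beta>')"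

subsection \<open>The algorithm\<close>

definition alpha_update :: "real ^ 't ^ 'r \<Rightarrow> real ^ 't \<Rightarrow> real ^ 'r" where
  "alpha_update P \<beta> = (1 / real CARD('t)) *\<^sub>R (P *v vec_inverse \<beta>)"

definition beta_update :: "real ^ 't ^ 'r \<Rightarrow> real ^ 'r \<Rightarrow> real ^ 't" where
  "beta_update P \<alpha> = (1 / real CARD('r)) *\<^sub>R (transpose P *v vec_inverse \<alpha>)"

primrec iterates :: "real ^ 't ^ 'r \<Rightarrow> nat \<Rightarrow> (real ^ 'r) \<times> (real ^ 't) \<times> ereal" where
  "iterates P 0 = (1, beta_update P 1, \<infinity>)"
| "iterates P (Suc \<kappa>) =
    (let (\<alpha>, \<beta>, j) = iterates P \<kappa>; \<alpha>' = alpha_update P \<beta>; \<beta>' = beta_update P \<alpha>'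
     in (\<alpha>', \<beta>', J P \<alpha>' \<beta>'))"

definition alpha_seq :: "real ^ 't ^ 'r \<Rightarrow> nat \<Rightarrow> real ^ 'r" where
  "alpha_seq P \<kappa> = fst (iterates P \<kappa>)"

definition beta_seq :: "real ^ 't ^ 'r \<Rightarrow> nat \<Rightarrow> real ^ 't" where
  "beta_seq P \<kappa> = fst (snd (iterates P \<kappa>))"

definition J_seq :: "real ^ 't ^ 'r \<Rightarrow> nat \<Rightarrow> ereal" where
  "J_seq P \<kappa> = snd (snd (iterates P \<kappa>))"

definition stops_at :: "real ^ 't ^ 'r \<Rightarrow> real \<Rightarrow> nat \<Rightarrow> bool" where
  "stops_at P \<epsilon> \<kappa> \<longleftrightarrow> 1 \<le> \<kappa> \<and> \<bar>J_seq P (\<kappa> - 1) - J_seq P \<kappa>\<bar> < ereal \<epsilon>"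

text \<open>Meaningful only if the stopping criterion is met at some iteration.\<close>

definition algorithm_output :: "real ^ 't ^ 'r \<Rightarrow> real \<Rightarrow> real ^ 't ^ 'r" where
  "algorithm_output P \<epsilon> =
     (let \<kappa> = (LEAST \<kappa>. stops_at P \<epsilon> \<kappa>) in outer (alpha_seq P \<kappa>) (beta_seq P \<kappa>))"

subsection \<open>Operation count\<close>

text \<open>A computation paired with its number of scalar operations: every arithmetic operation,
  inverse, logarithm, absolute value or comparison is wrapped in its own \<open>tick\<close>. Loops run
  over a list enumerating the index type, so that they can be executed step by step.\<close>

type_synonym 'a counted = "'a \<times> nat"

definition ret :: "'a \<Rightarrow> 'a counted" where
  "ret x = (x, 0)"

definition tick :: "'a \<Rightarrow> 'a counted" where
  "tick x = (x, 1)"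

definition cbind :: "'a counted \<Rightarrow> ('a \<Rightarrow> 'b counted) \<Rightarrow> 'b counted" (infixl "\<triangleright>" 54) where
  "m \<triangleright> f = (fst (f (fst m)), snd m + snd (f (fst m)))"

primrec sum_loop :: "('i \<Rightarrow> 'a::plus counted) \<Rightarrow> 'i list \<Rightarrow> 'a \<Rightarrow> 'a counted" where
  "sum_loop f [] s = ret s"
| "sum_loop f (i # is) s = f i \<triangleright> (\<lambda>y. tick (s + y) \<triangleright> (\<lambda>s'. sum_loop f is s'))"

primrec fill_loop :: "('n \<Rightarrow> real counted) \<Rightarrow> 'n list \<Rightarrow> real ^ 'n \<Rightarrow> (real ^ 'n) counted" where
  "fill_loop f [] v = ret v"
| "fill_loop f (i # is) v = f i \<triangleright> (\<lambda>y. fill_loop f is (vec_upd v i y))"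

definition inverse_prog :: "'n list \<Rightarrow> real ^ 'n \<Rightarrow> (real ^ 'n) counted" where
  "inverse_prog is v = fill_loop (\<lambda>i. tick (inverse (v $ i))) is 0"

definition alpha_prog :: "'r list \<Rightarrow> 't list \<Rightarrow> real ^ 't ^ 'r \<Rightarrow> real ^ 't \<Rightarrow> (real ^ 'r) counted" where
  "alpha_prog rs ts P \<beta> = inverse_prog ts \<beta> \<triangleright> (\<lambda>w.
     fill_loop (\<lambda>r. sum_loop (\<lambda>t. tick (P $ r $ t * w $ t)) ts 0 \<triangleright> (\<lambda>s.
       tick (s / real CARD('t)))) rs 0)"

definition beta_prog :: "'r list \<Rightarrow> 't list \<Rightarrow> real ^ 't ^ 'r \<Rightarrow> real ^ 'r \<Rightarrow> (real ^ 't) counted" where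
  "beta_prog rs ts P \<alpha> = inverse_prog rs \<alpha> \<triangleright> (\<lambda>w.
     fill_loop (\<lambda>t. sum_loop (\<lambda>r. tick (P $ r $ t * w $ r)) rs 0 \<triangleright> (\<lambda>s.
       tick (s / real CARD('r)))) ts 0)"

definition J_prog ::
  "'r list \<Rightarrow> 't list \<Rightarrow> real ^ 't ^ 'r \<Rightarrow> real ^ 'r \<Rightarrow> real ^ 't \<Rightarrow> ereal counted" where
  "J_prog rs ts P \<alpha> \<beta> =
     tick (real CARD('r) * real CARD('t)) \<triangleright> (\<lambda>n.
     tick (- ereal n) \<triangleright> (\<lambda>c.
     sum_loop (\<lambda>r. sum_loop (\<lambda>t.
         tick (\<alpha> $ r * \<beta> $ t) \<triangleright> (\<lambda>q.
         tick (P $ r $ t / q) \<triangleright> (\<lambda>u.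
         tick (eln u) \<triangleright> (\<lambda>l.
         tick (ereal u - l))))) ts 0) rs 0 \<triangleright> (\<lambda>s.
     tick (c + s))))"

text \<open>One pass of the loop, including the evaluation of the stopping criterion.\<close>

definition iteration_prog ::
  "'r list \<Rightarrow> 't list \<Rightarrow> real ^ 't ^ 'r \<Rightarrow> real \<Rightarrow> real ^ 't \<Rightarrow> ereal \<Rightarrow>
    ((real ^ 'r) \<times> (real ^ 't) \<times> ereal \<times> bool) counted" where
  "iteration_prog rs ts P \<epsilon> \<beta> j =
     alpha_prog rs ts P \<beta> \<triangleright> (\<lambda>\<alpha>'.
     beta_prog rs ts P \<alpha>' \<triangleright> (\<lambda>\<beta>'.
     J_prog rs ts P \<alpha>' \<beta>' \<triangleright> (\<lambda>j'.
     tick (j - j') \<triangleright> (\<lambda>d.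
     tick \<bar>d\<bar> \<triangleright> (\<lambda>e.
     tick (e < ereal \<epsilon>) \<triangleright> (\<lambda>stop.
     ret (\<alpha>', \<beta>', j', stop)))))))"

definition enumerates :: "'n list \<Rightarrow> bool" where
  "enumerates is \<longleftrightarrow> distinct is \<and> set is = UNIV"

end

theory Submission
  imports Defs
begin

text \<open>With \<open>Q = P / (\<alpha> \<beta>)\<close> entrywise, the two updates scale the rows of \<open>Q\<close> to sum to \<open>T\<close> and its
  columns to sum to \<open>R\<close>: the algorithm is Sinkhorn scaling. If all rows and columns of \<open>Q\<close> have these
  sums, then \<open>exp (- z) \<ge> 1 - z\<close> shows that \<open>(\<alpha>, \<beta>)\<close> minimizes the objective, and the equality case
  determines \<open>\<alpha> \<beta>\<^sup>T\<close>. For convergence, consider the ratios \<open>\<alpha>\<^sub>r\<^sup>(\<^sup>\<kappa>\<^sup>+\<^sup>1\<^sup>) / \<alpha>\<^sub>r\<^sup>(\<^sup>\<kappa>\<^sup>)\<close>. They have mean \<open>1\<close>, and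
  each round averages them with weights that are bounded below because \<open>P\<close> is positive. So they tend to
  \<open>1\<close> geometrically fast, and the logarithms of the iterates are Cauchy. No minimizer has to be known
  in advance.\<close>

section \<open>The coordinate-wise minimization steps\<close>

text \<open>A zero entry of \<open>P\<close> makes \<open>J\<close> identically infinite: it then
  has no derivatives, and every admissible pair minimizes it. \<open>J_var\<close>, which differs
  from \<open>J\<close> by a constant when \<open>P\<close> is positive, carries the descent
  statements in general. Convergence is stated for positive \<open>P\<close> only: for a triangular
  2 x 2 matrix with three positive entries, the required line sums would force a positive entry of Q
  to vanish, so even \<open>J_var\<close> has no stationary point. The value is invariant under (c
  \<alpha>, \<beta> / c), so descent alone does not select a limit of the factors; the ratios do.
  Contraction by itself only brings the ratios together; their mean 1, a consequence of the column
  sums after the \<beta> update, identifies the common limit.\<close>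

lemma vec_upd_nth [simp]: "vec_upd v i a $ j = (if j = i then a else v $ j)"
  by (simp add: vec_upd_def)

lemma outer_nth [simp]: "outer \<alpha> \<beta> $ r $ t = \<alpha> $ r * \<beta> $ t"
  by (simp add: outer_def)

lemma transpose_nth [simp]: "transpose A $ i $ j = A $ j $ i"
  by (simp add: transpose_def)

lemma pos_vecD: "pos_vec v \<Longrightarrow> 0 < v $ i"
  by (simp add: pos_vec_def)

lemma pos_vec_upd: "pos_vec v \<Longrightarrow> 0 < a \<Longrightarrow> pos_vec (vec_upd v i a)"
  by (simp add: pos_vec_def)

lemma pos_vec_exp: "pos_vec (vec_exp x)"
  by (simp add: pos_vec_def vec_exp_def)

lemma nonneg_if_pos_vec: "pos_vec v \<Longrightarrow> nonneg_vec v"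
  by (simp add: pos_vec_def nonneg_vec_def less_imp_le)

lemma alpha_update_nth:
  fixes P :: "real ^ 't ^ 'r"
  shows "alpha_update P \<beta> $ r = (\<Sum>t\<in>UNIV. P $ r $ t / \<beta> $ t) / real CARD('t)"
  by (simp add: alpha_update_def matrix_vector_mult_def vec_inverse_def divide_inverse)

text \<open>Transposition exchanges the two factors, so facts about the \<beta> update are inherited
  from the \<alpha> update.\<close>

lemma beta_update_eq: "beta_update P \<alpha> = alpha_update (transpose P) \<alpha>"
  by (simp add: alpha_update_def beta_update_def)

lemma J_var_transpose: "J_var (transpose P) \<beta> \<alpha> = J_var P \<alpha> \<beta>"
  unfolding J_var_def by (subst sum.swap) (simp add: mult.commute)

lemma var_stationary_in_beta_iff:
  "var_stationary_in_beta P \<alpha> \<beta> \<longleftrightarrow> var_stationary_in_alpha (transpose P) \<beta> \<alpha>"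
  by (simp add: var_stationary_in_beta_def var_stationary_in_alpha_def J_var_transpose)

lemma alpha_update_pos:
  fixes P :: "real ^ 't ^ 'r"
  assumes nn: "\<And>r t. 0 \<le> P $ r $ t" and rows: "\<And>r. row r P \<noteq> 0" and b: "pos_vec \<beta>"
  shows "pos_vec (alpha_update P \<beta>)"
  unfolding pos_vec_def
proof
  fix r
  obtain t where "P $ r $ t \<noteq> 0"
    using rows[of r] by (auto simp: row_def vec_eq_iff)
  then have "0 < P $ r $ t / \<beta> $ t"
    using nn[of r t] pos_vecD[OF b, of t] by simp
  then have "0 < (\<Sum>t\<in>UNIV. P $ r $ t / \<beta> $ t)"
    by (intro sum_pos2[of _ t]) (auto simp: nn less_imp_le[OF pos_vecD[OF b]])
  then show "0 < alpha_update P \<beta> $ r"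
    by (simp add: alpha_update_nth)
qed

lemma beta_update_pos:
  assumes "\<And>r t. 0 \<le> P $ r $ t" and "\<And>t. column t P \<noteq> 0" and "pos_vec \<alpha>"
  shows "pos_vec (beta_update P \<alpha>)"
  unfolding beta_update_eq using assms by (intro alpha_update_pos) auto

text \<open>The update equation read as a normalization of Q, the form in which stationarity enters
  the global optimality bound.\<close>

lemma alpha_update_row_sums:
  fixes P :: "real ^ 't ^ 'r"
  assumes "pos_vec (alpha_update P \<beta>)"
  shows "(\<Sum>t\<in>UNIV. P $ r $ t / (alpha_update P \<beta> $ r * \<beta> $ t)) = real CARD('t)"
proof -
  have "(\<Sum>t\<in>UNIV. P $ r $ t / (alpha_update P \<beta> $ r * \<beta> $ t))
      = (\<Sum>t\<in>UNIV. P $ r $ t / \<beta> $ t) / alpha_update P \<beta> $ r"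
    by (simp add: sum_divide_distrib mult.commute)
  also have "(\<Sum>t\<in>UNIV. P $ r $ t / \<beta> $ t) = real CARD('t) * alpha_update P \<beta> $ r"
    by (simp add: alpha_update_nth)
  finally show ?thesis
    using pos_vecD[OF assms, of r] by simp
qed

lemma beta_update_col_sums:
  fixes P :: "real ^ 't ^ 'r"
  assumes "pos_vec (beta_update P \<alpha>)"
  shows "(\<Sum>r\<in>UNIV. P $ r $ t / (\<alpha> $ r * beta_update P \<alpha> $ t)) = real CARD('r)"
  using alpha_update_row_sums[of "transpose P" \<alpha> t] assms
  by (simp add: beta_update_eq mult.commute)

text \<open>Differentiation gives T / a - S / a^2 at a = \<alpha>_r, with S the sum of row r of P /
  \<beta>. Factoring leaves a positive coefficient, so the update is the only positive zero.\<close>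

lemma J_var_vec_upd_derivative:
  fixes P :: "real ^ 't ^ 'r"
  assumes a: "pos_vec \<alpha>" and b: "pos_vec \<beta>"
  shows "((\<lambda>a. J_var P (vec_upd \<alpha> r a) \<beta>) has_real_derivative
    real CARD('t) / (\<alpha> $ r)\<^sup>2 * (\<alpha> $ r - alpha_update P \<beta> $ r)) (at (\<alpha> $ r))"
proof -
  have a': "0 < \<alpha> $ r" and b': "0 < \<beta> $ t" for t
    using a b by (auto simp: pos_vec_def)
  have split: "J_var P (vec_upd \<alpha> r a) \<beta> =
      (\<Sum>t\<in>UNIV. P $ r $ t / (a * \<beta> $ t) + ln (a * \<beta> $ t)) +
      (\<Sum>s\<in>UNIV - {r}. \<Sum>t\<in>UNIV. P $ s $ t / (\<alpha> $ s * \<beta> $ t) + ln (\<alpha> $ s * \<beta> $ t))" for a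
    unfolding J_var_def by (subst sum.remove[of _ r]) (auto intro!: sum.cong)
  have "((\<lambda>a. P $ r $ t / (a * \<beta> $ t) + ln (a * \<beta> $ t)) has_real_derivative
      (1 / \<alpha> $ r - P $ r $ t / \<beta> $ t / (\<alpha> $ r)\<^sup>2)) (at (\<alpha> $ r))" for t
    using a' b'[of t]
    by (auto intro!: derivative_eq_intros simp: field_simps power2_eq_square)
  then have "((\<lambda>a. \<Sum>t\<in>UNIV. P $ r $ t / (a * \<beta> $ t) + ln (a * \<beta> $ t)) has_real_derivative
      (\<Sum>t\<in>UNIV. 1 / \<alpha> $ r - P $ r $ t / \<beta> $ t / (\<alpha> $ r)\<^sup>2)) (at (\<alpha> $ r))"
    by (intro DERIV_sum)
  moreover have "(\<Sum>t\<in>UNIV. 1 / \<alpha> $ r - P $ r $ t / \<beta> $ t / (\<alpha> $ r)\<^sup>2)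
      = real CARD('t) / \<alpha> $ r - real CARD('t) * alpha_update P \<beta> $ r / (\<alpha> $ r)\<^sup>2"
    unfolding sum_subtractf alpha_update_nth sum_divide_distrib[symmetric] by simp
  moreover have "\<dots> = real CARD('t) / (\<alpha> $ r)\<^sup>2 * (\<alpha> $ r - alpha_update P \<beta> $ r)"
    using a' by (simp add: field_simps power2_eq_square)
  ultimately have "((\<lambda>a. \<Sum>t\<in>UNIV. P $ r $ t / (a * \<beta> $ t) + ln (a * \<beta> $ t)) has_real_derivative
      real CARD('t) / (\<alpha> $ r)\<^sup>2 * (\<alpha> $ r - alpha_update P \<beta> $ r)) (at (\<alpha> $ r))"
    by simp
  from DERIV_add[OF this DERIV_const] show ?thesis
    unfolding split by simp
qed

lemma var_stationary_in_alpha_iff: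
  fixes P :: "real ^ 't ^ 'r"
  assumes a: "pos_vec \<alpha>" and b: "pos_vec \<beta>"
  shows "var_stationary_in_alpha P \<alpha> \<beta> \<longleftrightarrow> \<alpha> = alpha_update P \<beta>"
proof -
  have "((\<lambda>a. J_var P (vec_upd \<alpha> r a) \<beta>) has_real_derivative 0) (at (\<alpha> $ r))
      \<longleftrightarrow> real CARD('t) / (\<alpha> $ r)\<^sup>2 * (\<alpha> $ r - alpha_update P \<beta> $ r) = 0" for r
    using J_var_vec_upd_derivative[OF a b, of P r] DERIV_unique by metis
  moreover have "\<alpha> $ r \<noteq> 0" for r
    using pos_vecD[OF a, of r] by simp
  ultimately show ?thesis
    by (auto simp: var_stationary_in_alpha_def vec_eq_iff)
qed

lemma var_stationary_in_beta_iff_update: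
  assumes "pos_vec \<alpha>" and "pos_vec \<beta>"
  shows "var_stationary_in_beta P \<alpha> \<beta> \<longleftrightarrow> \<beta> = beta_update P \<alpha>"
  using assms by (simp add: var_stationary_in_beta_iff var_stationary_in_alpha_iff beta_update_eq)

section \<open>Finite and infinite values of the objective\<close>

text \<open>A zero entry and a zero factor (through \<open>x / 0 = 0\<close>) both give a
  nonpositive quotient, and one infinite summand makes an \<open>ereal\<close> sum infinite.\<close>

lemma J_eq_PInfty:
  fixes P :: "real ^ 't ^ 'r"
  assumes "P $ r $ t / (\<alpha> $ r * \<beta> $ t) \<le> 0"
  shows "J P \<alpha> \<beta> = \<infinity>"
proof -
  have "ereal (P $ r $ t / (\<alpha> $ r * \<beta> $ t)) - eln (P $ r $ t / (\<alpha> $ r * \<beta> $ t)) = \<infinity>"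
    using assms by (simp add: eln_def)
  then have "(\<Sum>t\<in>UNIV. ereal (P $ r $ t / (\<alpha> $ r * \<beta> $ t)) -
      eln (P $ r $ t / (\<alpha> $ r * \<beta> $ t))) = \<infinity>"
    unfolding sum_Pinfty by (intro conjI finite bexI[where x = t] UNIV_I)
  then have "(\<Sum>r\<in>UNIV. \<Sum>t\<in>UNIV. ereal (P $ r $ t / (\<alpha> $ r * \<beta> $ t)) -
      eln (P $ r $ t / (\<alpha> $ r * \<beta> $ t))) = \<infinity>"
    unfolding sum_Pinfty[of _ "UNIV :: 'r set"] by (intro conjI finite bexI[where x = r] UNIV_I)
  then show ?thesis
    by (simp add: J_def)
qed

text \<open>Discards boundary competitors: against a finite value only positive vectors have to be
  compared.\<close>

lemma J_finite_imp_pos: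
  fixes P :: "real ^ 't ^ 'r"
  assumes "J P \<alpha> \<beta> \<noteq> \<infinity>" "\<And>r t. 0 \<le> P $ r $ t" "nonneg_vec \<alpha>" "nonneg_vec \<beta>"
  shows "(\<forall>r t. 0 < P $ r $ t) \<and> pos_vec \<alpha> \<and> pos_vec \<beta>"
proof -
  have "0 < P $ r $ t / (\<alpha> $ r * \<beta> $ t)" for r t
    using J_eq_PInfty[of P r t \<alpha> \<beta>] assms(1) by (metis not_less)
  then have "P $ r $ t \<noteq> 0 \<and> \<alpha> $ r \<noteq> 0 \<and> \<beta> $ t \<noteq> 0" for r t
    by (metis divide_eq_0_iff less_irrefl mult_eq_0_iff)
  with assms(2-4) show ?thesis
    unfolding pos_vec_def nonneg_vec_def by (metis less_eq_real_def)
qed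

lemma J_zero_entry:
  assumes "\<And>r t. 0 \<le> P $ r $ t" "\<not> (\<forall>r t. 0 < P $ r $ t)"
  shows "J P \<alpha> \<beta> = \<infinity>"
proof -
  obtain r t where "P $ r $ t = 0"
    using assms by (metis less_eq_real_def)
  then show ?thesis
    using J_eq_PInfty[of P r t \<alpha> \<beta>] by simp
qed

lemma J_le_iff_J_var_le:
  assumes "\<And>r t. 0 < P $ r $ t" "pos_vec \<alpha>" "pos_vec \<beta>" "pos_vec \<alpha>'" "pos_vec \<beta>'"
  shows "J P \<alpha> \<beta> \<le> J P \<alpha>' \<beta>' \<longleftrightarrow> J_var P \<alpha> \<beta> \<le> J_var P \<alpha>' \<beta>'"
  using assms by (simp add: J_eq_J_var)

lemma J_mono_if_J_var_mono:
  assumes "\<And>r t. 0 \<le> P $ r $ t" "pos_vec \<alpha>" "pos_vec \<beta>" "pos_vec \<alpha>'" "pos_vec \<beta>'"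
    and "J_var P \<alpha> \<beta> \<le> J_var P \<alpha>' \<beta>'"
  shows "J P \<alpha> \<beta> \<le> J P \<alpha>' \<beta>'"
  using assms by (cases "\<forall>r t. 0 < P $ r $ t") (auto simp: J_le_iff_J_var_le J_zero_entry)

text \<open>Entrywise this is u - ln u \<ge> 1, and the R T lower bounds of 1 cancel the summand - R
  T.\<close>

lemma J_nonneg:
  fixes P :: "real ^ 't ^ 'r"
  assumes "\<And>r t. 0 \<le> P $ r $ t" "nonneg_vec \<alpha>" "nonneg_vec \<beta>"
  shows "0 \<le> J P \<alpha> \<beta>"
proof (cases "J P \<alpha> \<beta> = \<infinity>")
  case False
  then have P: "0 < P $ r $ t" and a: "pos_vec \<alpha>" and b: "pos_vec \<beta>" for r t
    using J_finite_imp_pos assms by blast+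
  have "1 \<le> P $ r $ t / (\<alpha> $ r * \<beta> $ t) + ln (\<alpha> $ r * \<beta> $ t) - ln (P $ r $ t)" for r t
  proof -
    have "0 < \<alpha> $ r * \<beta> $ t"
      using pos_vecD[OF a, of r] pos_vecD[OF b, of t] by simp
    then show ?thesis
      using ln_le_minus_one[of "P $ r $ t / (\<alpha> $ r * \<beta> $ t)"] P[of r t] by (simp add: ln_divide_pos)
  qed
  then have "(\<Sum>r\<in>(UNIV :: 'r set). \<Sum>t\<in>(UNIV :: 't set). 1) \<le> (\<Sum>r\<in>UNIV. \<Sum>t\<in>UNIV.
      P $ r $ t / (\<alpha> $ r * \<beta> $ t) + ln (\<alpha> $ r * \<beta> $ t) - ln (P $ r $ t))"
    by (intro sum_mono)
  also have "\<dots> = J_var P \<alpha> \<beta> - (\<Sum>r\<in>UNIV. \<Sum>t\<in>UNIV. ln (P $ r $ t))"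
    by (simp add: J_var_def sum_subtractf)
  finally show ?thesis
    unfolding J_eq_J_var[OF P a b] by simp
qed simp

lemma J_eq_0_iff:
  fixes P :: "real ^ 't ^ 'r"
  assumes P: "\<And>r t. 0 < P $ r $ t" and a: "pos_vec \<alpha>" and b: "pos_vec \<beta>"
  shows "J P \<alpha> \<beta> = 0 \<longleftrightarrow> P = outer \<alpha> \<beta>"
proof -
  define u where "u = (\<lambda>r t. P $ r $ t / (\<alpha> $ r * \<beta> $ t))"
  have ab: "0 < \<alpha> $ r * \<beta> $ t" for r t
    using pos_vecD[OF a, of r] pos_vecD[OF b, of t] by simp
  have u: "0 < u r t" for r t
    using ab[of r t] P[of r t] by (simp add: u_def)
  \<comment> \<open>Spreading - R T over the entries as - 1 makes every summand nonnegative, and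
    zero exactly where \<open>u\<close> is 1.\<close>
  define v where "v = (\<lambda>r t. u r t - ln (u r t) - 1)"
  have v: "0 \<le> v r t" and v_0: "v r t = 0 \<longleftrightarrow> u r t = 1" for r t
    using ln_le_minus_one[OF u, of r t] ln_eq_minus_one[OF u, of r t] by (auto simp: v_def)
  have "J P \<alpha> \<beta> = ereal (\<Sum>r\<in>UNIV. \<Sum>t\<in>UNIV. v r t)"
    unfolding J_eq_J_var[OF P a b] J_var_def v_def u_def
    by (simp add: ln_divide_pos[OF P ab] sum.distrib sum_subtractf)
  then have "J P \<alpha> \<beta> = 0 \<longleftrightarrow> (\<forall>r t. v r t = 0)"
    by (simp add: sum_nonneg_eq_0_iff sum_nonneg v)
  also have "\<dots> \<longleftrightarrow> (\<forall>r t. u r t = 1)"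
    by (simp add: v_0)
  also have "\<dots> \<longleftrightarrow> P = outer \<alpha> \<beta>"
    using ab less_imp_neq[OF ab] by (simp add: u_def vec_eq_iff divide_eq_eq)
  finally show ?thesis .
qed

section \<open>Stationarity of the extended-real objective\<close>

text \<open>The real representative is determined only near \<open>x\<close>, but local agreement
  already fixes the derivative, and the constant drops out.\<close>

lemma has_ereal_derivative_iff:
  fixes f :: "real \<Rightarrow> ereal"
  assumes "\<forall>\<^sub>F a in nhds x. f a = ereal (g a - c)"
  shows "has_ereal_derivative f D x \<longleftrightarrow> (g has_real_derivative D) (at x)"
proof
  assume "has_ereal_derivative f D x"
  then obtain h where h: "\<forall>\<^sub>F a in nhds x. f a = ereal (h a)" "(h has_real_derivative D) (at x)"
    by (auto simp: has_ereal_derivative_def)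
  have "\<forall>\<^sub>F a in nhds x. h a = g a - c"
    using h(1) assms by eventually_elim simp
  then have "((\<lambda>a. g a - c) has_real_derivative D) (at x)"
    using h(2) by (subst (asm) DERIV_cong_ev[OF refl _ refl])
  then have "((\<lambda>a. g a - c + c) has_real_derivative D + 0) (at x)"
    by (intro DERIV_add DERIV_const)
  then show "(g has_real_derivative D) (at x)" by simp
next
  assume "(g has_real_derivative D) (at x)"
  then have "((\<lambda>a. g a - c) has_real_derivative D - 0) (at x)"
    by (intro DERIV_diff DERIV_const)
  then show "has_ereal_derivative f D x"
    using assms unfolding has_ereal_derivative_def by auto
qed

lemma stationary_in_alpha_iff:
  fixes P :: "real ^ 't ^ 'r"
  assumes P: "\<And>r t. 0 < P $ r $ t" and a: "pos_vec \<alpha>" and b: "pos_vec \<beta>"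
  shows "stationary_in_alpha P \<alpha> \<beta> \<longleftrightarrow> var_stationary_in_alpha P \<alpha> \<beta>"
proof -
  have "has_ereal_derivative (\<lambda>a. J P (vec_upd \<alpha> r a) \<beta>) 0 (\<alpha> $ r) \<longleftrightarrow>
      ((\<lambda>a. J_var P (vec_upd \<alpha> r a) \<beta>) has_real_derivative 0) (at (\<alpha> $ r))" for r
  \<comment> \<open>Positivity of a coordinate is an open condition, so \<open>J\<close> equals
    \<open>J_var\<close> minus a constant on a whole neighbourhood.\<close>
  proof (rule has_ereal_derivative_iff)
    have "\<forall>\<^sub>F x in nhds (\<alpha> $ r). 0 < x"
      using pos_vecD[OF a] by (intro eventually_nhds_in_open[of "{0<..}", simplified]) auto
    then show "\<forall>\<^sub>F x in nhds (\<alpha> $ r). J P (vec_upd \<alpha> r x) \<beta> = ereal (J_var P (vec_upd \<alpha> r x) \<beta> -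
        (real CARD('r) * real CARD('t) + (\<Sum>r\<in>UNIV. \<Sum>t\<in>UNIV. ln (P $ r $ t))))"
      by eventually_elim (simp add: J_eq_J_var P b pos_vec_upd[OF a])
  qed
  then show ?thesis
    by (simp add: stationary_in_alpha_def var_stationary_in_alpha_def)
qed

lemma stationary_in_beta_iff:
  fixes P :: "real ^ 't ^ 'r"
  assumes P: "\<And>r t. 0 < P $ r $ t" and a: "pos_vec \<alpha>" and b: "pos_vec \<beta>"
  shows "stationary_in_beta P \<alpha> \<beta> \<longleftrightarrow> var_stationary_in_beta P \<alpha> \<beta>"
proof -
  have "has_ereal_derivative (\<lambda>x. J P \<alpha> (vec_upd \<beta> t x)) 0 (\<beta> $ t) \<longleftrightarrow>
      ((\<lambda>x. J_var P \<alpha> (vec_upd \<beta> t x)) has_real_derivative 0) (at (\<beta> $ t))" for t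
  proof (rule has_ereal_derivative_iff)
    have "\<forall>\<^sub>F x in nhds (\<beta> $ t). 0 < x"
      using pos_vecD[OF b] by (intro eventually_nhds_in_open[of "{0<..}", simplified]) auto
    then show "\<forall>\<^sub>F x in nhds (\<beta> $ t). J P \<alpha> (vec_upd \<beta> t x) = ereal (J_var P \<alpha> (vec_upd \<beta> t x) -
        (real CARD('r) * real CARD('t) + (\<Sum>r\<in>UNIV. \<Sum>t\<in>UNIV. ln (P $ r $ t))))"
      by eventually_elim (simp add: J_eq_J_var P a pos_vec_upd[OF b])
  qed
  then show ?thesis
    by (simp add: stationary_in_beta_def var_stationary_in_beta_def)
qed

text \<open>A derivative requires a real representative near the point, which cannot exist where
  \<open>J\<close> is identically infinite.\<close>

lemma stationary_point_imp_pos: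
  assumes nn: "\<And>r t. 0 \<le> P $ r $ t" and s: "stationary_point P \<alpha> \<beta>"
  shows "\<forall>r t. 0 < P $ r $ t"
proof (rule ccontr)
  assume "\<not> ?thesis"
  then have inf: "J P \<alpha>' \<beta>' = \<infinity>" for \<alpha>' \<beta>'
    by (intro J_zero_entry nn) auto
  obtain g where "\<forall>\<^sub>F a in nhds (\<alpha> $ undefined). J P (vec_upd \<alpha> undefined a) \<beta> = ereal (g a)"
    using s by (auto simp: stationary_point_def stationary_in_alpha_def has_ereal_derivative_def)
  then show False
    by (auto simp: inf dest: eventually_nhds_x_imp_x)
qed

section \<open>Global optimality\<close>

text \<open>With \<open>z = ln (\<alpha>' \<beta>' / (\<alpha> \<beta>))\<close> entrywise, \<open>exp (- z) \<ge> 1 - z\<close> bounds the increase of the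
  objective from below by \<open>\<Sum> (1 - Q) z\<close> where \<open>Q = P / (\<alpha> \<beta>)\<close>. If the line sums of \<open>Q\<close> are those
  of the all-ones matrix, then this bound vanishes.\<close>

lemma J_var_minimal:
  fixes P :: "real ^ 't ^ 'r"
  assumes nn: "\<And>r t. 0 \<le> P $ r $ t"
    and a: "pos_vec \<alpha>" and b: "pos_vec \<beta>" and a': "pos_vec \<alpha>'" and b': "pos_vec \<beta>'"
    and row: "\<alpha>' = \<alpha> \<or> (\<forall>r. (\<Sum>t\<in>UNIV. P $ r $ t / (\<alpha> $ r * \<beta> $ t)) = real CARD('t))"
    and col: "\<beta>' = \<beta> \<or> (\<forall>t. (\<Sum>r\<in>UNIV. P $ r $ t / (\<alpha> $ r * \<beta> $ t)) = real CARD('r))"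
  shows "J_var P \<alpha> \<beta> \<le> J_var P \<alpha>' \<beta>'"
    and "(\<And>r t. 0 < P $ r $ t) \<Longrightarrow> J_var P \<alpha> \<beta> = J_var P \<alpha>' \<beta>' \<Longrightarrow> outer \<alpha>' \<beta>' = outer \<alpha> \<beta>"
proof -
  define Q where "Q r t = P $ r $ t / (\<alpha> $ r * \<beta> $ t)" for r t
  define x where "x r = ln (\<alpha>' $ r / \<alpha> $ r)" for r
  define y where "y t = ln (\<beta>' $ t / \<beta> $ t)" for t
  \<comment> \<open>With z = x + y, a summand changes by Q (exp (- z) - 1) + z = Q (exp (- z) - 1 +
    z) + (1 - Q) z; \<open>g\<close> is the nonnegative first part.\<close>
  define g where "g r t = Q r t * (exp (- (x r + y t)) - 1 + (x r + y t))" for r t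
  note pos = pos_vecD[OF a] pos_vecD[OF b] pos_vecD[OF a'] pos_vecD[OF b']
  have Q: "0 \<le> Q r t" for r t
    using nn[of r t] pos(1)[of r] pos(2)[of t] by (simp add: Q_def)
  have e: "exp (x r + y t) = \<alpha>' $ r * \<beta>' $ t / (\<alpha> $ r * \<beta> $ t)" for r t
    using pos(1,3)[of r] pos(2,4)[of t] by (simp add: x_def y_def exp_add)
  \<comment> \<open>Either the factor is unchanged and its logarithmic ratio vanishes, or the row
    sums of 1 - Q vanish. This alternative lets one bound serve both the half-steps and the global
    comparison.\<close>
  have xs: "(\<Sum>r\<in>UNIV. \<Sum>t\<in>UNIV. (1 - Q r t) * x r) = 0"
  proof (cases "\<alpha>' = \<alpha>")
    case True
    have "x r = 0" for r using pos(1)[of r] True by (simp add: x_def)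
    then show ?thesis by simp
  next
    case False
    then have "(\<Sum>t\<in>UNIV. 1 - Q r t) = 0" for r
      using row by (simp add: sum_subtractf Q_def)
    then show ?thesis by (simp flip: sum_distrib_right)
  qed
  have ys: "(\<Sum>r\<in>UNIV. \<Sum>t\<in>UNIV. (1 - Q r t) * y t) = 0"
  proof (cases "\<beta>' = \<beta>")
    case True
    have "y t = 0" for t using pos(2)[of t] True by (simp add: y_def)
    then show ?thesis by simp
  next
    case False
    then have "(\<Sum>r\<in>UNIV. 1 - Q r t) = 0" for t
      using col by (simp add: sum_subtractf Q_def)
    then show ?thesis by (subst sum.swap) (simp flip: sum_distrib_right)
  qed
  have "P $ r $ t / (\<alpha>' $ r * \<beta>' $ t) + ln (\<alpha>' $ r * \<beta>' $ t)
      = P $ r $ t / (\<alpha> $ r * \<beta> $ t) + ln (\<alpha> $ r * \<beta> $ t)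
        + (g r t + ((1 - Q r t) * x r + (1 - Q r t) * y t))" for r t
  proof -
    have "ln (\<alpha>' $ r * \<beta>' $ t) = ln (\<alpha> $ r * \<beta> $ t) + (x r + y t)"
      using pos(1,3)[of r] pos(2,4)[of t] by (simp add: x_def y_def ln_mult ln_divide_pos)
    moreover have "P $ r $ t / (\<alpha>' $ r * \<beta>' $ t) = Q r t * exp (- (x r + y t))"
      unfolding exp_minus e Q_def using pos(1,3)[of r] pos(2,4)[of t] by (simp add: field_simps)
    ultimately show ?thesis
      by (simp add: g_def Q_def[symmetric] algebra_simps)
  qed
  then have diff: "J_var P \<alpha>' \<beta>' = J_var P \<alpha> \<beta> + (\<Sum>r\<in>UNIV. \<Sum>t\<in>UNIV. g r t)"
    using xs ys unfolding J_var_def by (simp add: sum.distrib)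
  have g: "0 \<le> g r t" for r t
    using exp_ge_add_one_self[of "- (x r + y t)"] unfolding g_def
    by (intro mult_nonneg_nonneg Q) linarith
  show "J_var P \<alpha> \<beta> \<le> J_var P \<alpha>' \<beta>'"
    unfolding diff by (simp add: sum_nonneg g)
  assume P: "\<And>r t. 0 < P $ r $ t" and eq: "J_var P \<alpha> \<beta> = J_var P \<alpha>' \<beta>'"
  have "g r t = 0" for r t
    using eq unfolding diff by (simp add: sum_nonneg_eq_0_iff sum_nonneg g)
  moreover have "Q r t \<noteq> 0" for r t
    using P[of r t] pos(1)[of r] pos(2)[of t] by (simp add: Q_def)
  ultimately have "exp (- (x r + y t)) - 1 + (x r + y t) = 0" for r t
    by (metis g_def mult_eq_0_iff)
  \<comment> \<open>Equality case of ln u \<le> u - 1 at u =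
    \<open>exp (- (x r + y t))\<close>.\<close>
  then have "x r + y t = 0" for r t
    using ln_eq_minus_one[of "exp (- (x r + y t))"] by (simp add: algebra_simps)
  then have "\<alpha>' $ r * \<beta>' $ t = \<alpha> $ r * \<beta> $ t" for r t
    using e[of r t] pos(1)[of r] pos(2)[of t] by (simp add: eq_divide_eq)
  then show "outer \<alpha>' \<beta>' = outer \<alpha> \<beta>"
    by (simp add: vec_eq_iff)
qed

text \<open>The half-step is the instance with \<beta> kept fixed. A vanishing derivative would not
  suffice by itself, as the objective is not convex in \<alpha>.\<close>

lemma J_var_alpha_update_le:
  assumes "\<And>r t. 0 \<le> P $ r $ t" and "pos_vec \<alpha>" "pos_vec \<beta>" "pos_vec (alpha_update P \<beta>)"
  shows "J_var P (alpha_update P \<beta>) \<beta> \<le> J_var P \<alpha> \<beta>"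
  using assms by (intro J_var_minimal(1)) (auto simp: alpha_update_row_sums)

lemma J_var_beta_update_le:
  assumes "\<And>r t. 0 \<le> P $ r $ t" and "pos_vec \<alpha>" "pos_vec \<beta>" "pos_vec (beta_update P \<alpha>)"
  shows "J_var P \<alpha> (beta_update P \<alpha>) \<le> J_var P \<alpha> \<beta>"
  using assms by (intro J_var_minimal(1)) (auto simp: beta_update_col_sums)

lemma J_var_stationary_minimal:
  assumes nn: "\<And>r t. 0 \<le> P $ r $ t"
    and a: "pos_vec \<alpha>" and b: "pos_vec \<beta>" and a': "pos_vec \<alpha>'" and b': "pos_vec \<beta>'"
    and sa: "\<alpha> = alpha_update P \<beta>" and sb: "\<beta> = beta_update P \<alpha>"
  shows "J_var P \<alpha> \<beta> \<le> J_var P \<alpha>' \<beta>'"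
    and "(\<And>r t. 0 < P $ r $ t) \<Longrightarrow> J_var P \<alpha> \<beta> = J_var P \<alpha>' \<beta>' \<Longrightarrow> outer \<alpha>' \<beta>' = outer \<alpha> \<beta>"
  using J_var_minimal[OF nn a b a' b'] alpha_update_row_sums[of P \<beta>] beta_update_col_sums[of P \<alpha>] a b
  by (simp_all flip: sa sb)

lemma stationary_point_iff_updates:
  assumes "\<And>r t. 0 < P $ r $ t"
  shows "stationary_point P \<alpha> \<beta> \<longleftrightarrow>
    pos_vec \<alpha> \<and> pos_vec \<beta> \<and> \<alpha> = alpha_update P \<beta> \<and> \<beta> = beta_update P \<alpha>"
  using assms
  by (auto simp: stationary_point_def stationary_in_alpha_iff stationary_in_beta_iff
      var_stationary_in_alpha_iff var_stationary_in_beta_iff_update)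

lemma stationary_point_imp_global_minimizer:
  assumes nn: "\<And>r t. 0 \<le> P $ r $ t" and s: "stationary_point P \<alpha> \<beta>"
  shows "global_minimizer P \<alpha> \<beta>"
proof -
  have P: "0 < P $ r $ t" for r t
    using stationary_point_imp_pos[OF nn s] by blast
  have st: "pos_vec \<alpha>" "pos_vec \<beta>" "\<alpha> = alpha_update P \<beta>" "\<beta> = beta_update P \<alpha>"
    using s stationary_point_iff_updates[OF P] by blast+
  have "J P \<alpha> \<beta> \<le> J P \<alpha>' \<beta>'" if "nonneg_vec \<alpha>'" "nonneg_vec \<beta>'" for \<alpha>' \<beta>'
  proof (cases "J P \<alpha>' \<beta>' = \<infinity>")
    case False
    then have "pos_vec \<alpha>'" "pos_vec \<beta>'"
      using J_finite_imp_pos[OF _ nn that] by auto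
    then show ?thesis
      using J_var_stationary_minimal(1)[OF nn st(1,2) _ _ st(3,4)] st(1,2)
      by (simp add: J_le_iff_J_var_le P)
  qed simp
  then show ?thesis
    using st(1,2) by (simp add: global_minimizer_def nonneg_if_pos_vec)
qed

text \<open>Only the product can be unique, because (c \<alpha>, \<beta> / c) has the same value.
  Finiteness of the minimal value makes the competing minimizer positive, and then the equality case
  applies.\<close>

lemma global_minimizer_outer_unique:
  assumes P: "\<And>r t. 0 < P $ r $ t" and s: "stationary_point P \<alpha> \<beta>" and m: "global_minimizer P \<alpha>' \<beta>'"
  shows "outer \<alpha>' \<beta>' = outer \<alpha> \<beta>"
proof -
  have nn: "0 \<le> P $ r $ t" for r t
    using P by (simp add: less_imp_le)
  have st: "pos_vec \<alpha>" "pos_vec \<beta>" "\<alpha> = alpha_update P \<beta>" "\<beta> = beta_update P \<alpha>"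
    using s stationary_point_iff_updates[OF P] by blast+
  have nn': "nonneg_vec \<alpha>'" "nonneg_vec \<beta>'" and le: "J P \<alpha>' \<beta>' \<le> J P \<alpha> \<beta>"
    using m st(1,2) by (auto simp: global_minimizer_def nonneg_if_pos_vec)
  have "J P \<alpha>' \<beta>' \<noteq> \<infinity>"
    using le by (auto simp: J_eq_J_var[OF P st(1,2)])
  then have pos: "pos_vec \<alpha>'" "pos_vec \<beta>'"
    using J_finite_imp_pos[OF _ nn nn'] by auto
  have "J_var P \<alpha>' \<beta>' \<le> J_var P \<alpha> \<beta>"
    using le st(1,2) pos by (simp add: J_le_iff_J_var_le P)
  then have "J_var P \<alpha> \<beta> = J_var P \<alpha>' \<beta>'"
    using J_var_stationary_minimal(1)[OF nn st(1,2) pos st(3,4)] by linarith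
  then show ?thesis
    by (rule J_var_stationary_minimal(2)[OF nn st(1,2) pos st(3,4) P])
qed

section \<open>Convexity in the logarithms\<close>

lemma J_var_vec_exp:
  "J_var P (vec_exp x) (vec_exp y) =
    (\<Sum>r\<in>UNIV. \<Sum>t\<in>UNIV. P $ r $ t * exp (- (x $ r + y $ t)) + (x $ r + y $ t))"
proof -
  have "P $ r $ t / (exp (x $ r) * exp (y $ t)) = P $ r $ t * exp (- (x $ r + y $ t))" for r t
    unfolding exp_minus exp_add divide_inverse by simp
  moreover have "ln (exp (x $ r) * exp (y $ t)) = x $ r + y $ t" for r t
    by (simp add: ln_mult)
  ultimately show ?thesis
    by (simp only: J_var_def vec_exp_def vec_lambda_beta)
qed

text \<open>In logarithmic coordinates each summand is a nonnegative multiple of the exponential of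
  a linear form, plus a linear form.\<close>

lemma J_var_vec_exp_convex:
  fixes P :: "real ^ 't ^ 'r"
  assumes nn: "\<And>r t. 0 \<le> P $ r $ t"
  shows "convex_on UNIV (\<lambda>(x, y). J_var P (vec_exp x) (vec_exp y))"
proof (rule convex_onI)
  fix \<theta> :: real and z w :: "(real ^ 'r) \<times> (real ^ 't)"
  assume \<theta>: "0 < \<theta>" "\<theta> < 1"
  obtain x y x' y' where zw: "z = (x, y)" "w = (x', y')"
    by (metis surj_pair)
  define s where "s r t = x $ r + y $ t" for r t
  define s' where "s' r t = x' $ r + y' $ t" for r t
  have lin: "((1 - \<theta>) *\<^sub>R x + \<theta> *\<^sub>R x') $ r + ((1 - \<theta>) *\<^sub>R y + \<theta> *\<^sub>R y') $ t
      = (1 - \<theta>) * s r t + \<theta> * s' r t" for r t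
    by (simp add: s_def s'_def algebra_simps)
  have "exp (- ((1 - \<theta>) * s r t + \<theta> * s' r t))
      \<le> (1 - \<theta>) * exp (- s r t) + \<theta> * exp (- s' r t)" for r t
    using convex_onD[OF exp_convex, of \<theta> "- s r t" "- s' r t"] \<theta> by simp
  then have "P $ r $ t * exp (- ((1 - \<theta>) * s r t + \<theta> * s' r t))
      \<le> P $ r $ t * ((1 - \<theta>) * exp (- s r t) + \<theta> * exp (- s' r t))" for r t
    by (intro mult_left_mono nn)
  moreover have "P $ r $ t * ((1 - \<theta>) * exp (- s r t) + \<theta> * exp (- s' r t))
      + ((1 - \<theta>) * s r t + \<theta> * s' r t)
      = (1 - \<theta>) * (P $ r $ t * exp (- s r t) + s r t) + \<theta> * (P $ r $ t * exp (- s' r t) + s' r t)" for r t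
    by algebra
  ultimately have "P $ r $ t * exp (- ((1 - \<theta>) * s r t + \<theta> * s' r t)) + ((1 - \<theta>) * s r t + \<theta> * s' r t)
      \<le> (1 - \<theta>) * (P $ r $ t * exp (- s r t) + s r t) + \<theta> * (P $ r $ t * exp (- s' r t) + s' r t)" for r t
    by (metis add_le_cancel_right)
  then show "(case (1 - \<theta>) *\<^sub>R z + \<theta> *\<^sub>R w of (x, y) \<Rightarrow> J_var P (vec_exp x) (vec_exp y))
      \<le> (1 - \<theta>) * (case z of (x, y) \<Rightarrow> J_var P (vec_exp x) (vec_exp y)) +
        \<theta> * (case w of (x, y) \<Rightarrow> J_var P (vec_exp x) (vec_exp y))"
    unfolding zw scaleR_Pair add_Pair prod.case J_var_vec_exp lin
    unfolding s_def[symmetric] s'_def[symmetric] sum_distrib_left sum.distrib[symmetric]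
    by (intro sum_mono)
qed simp

lemma J_vec_exp_ereal_convex:
  fixes P :: "real ^ 't ^ 'r"
  assumes nn: "\<And>r t. 0 \<le> P $ r $ t"
  shows "ereal_convex (\<lambda>(x, y). J P (vec_exp x) (vec_exp y))"
proof (cases "\<forall>r t. 0 < P $ r $ t")
  case True
  define c where "c = real CARD('r) * real CARD('t) + (\<Sum>r\<in>UNIV. \<Sum>t\<in>UNIV. ln (P $ r $ t))"
  define f where "f = (\<lambda>z. case z of (x, y) \<Rightarrow> J_var P (vec_exp x) (vec_exp y))"
  have J: "(\<lambda>(x, y). J P (vec_exp x) (vec_exp y)) = (\<lambda>z. ereal (f z - c))"
    using True by (auto simp: fun_eq_iff f_def c_def J_eq_J_var pos_vec_exp)
  show ?thesis
    unfolding J ereal_convex_def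
  proof (intro allI ballI)
    fix z w :: "(real ^ 'r) \<times> (real ^ 't)" and \<theta> :: real
    assume "\<theta> \<in> {0..1}"
    then have "f ((1 - \<theta>) *\<^sub>R z + \<theta> *\<^sub>R w) \<le> (1 - \<theta>) * f z + \<theta> * f w"
      using convex_onD[OF J_var_vec_exp_convex[OF nn], of \<theta> z w] by (simp add: f_def)
    then show "ereal (f ((1 - \<theta>) *\<^sub>R z + \<theta> *\<^sub>R w) - c)
        \<le> ereal (1 - \<theta>) * ereal (f z - c) + ereal \<theta> * ereal (f w - c)"
      by (simp add: algebra_simps)
  qed
next
  case False
  then have inf: "J P \<alpha> \<beta> = \<infinity>" for \<alpha> \<beta>
    by (rule J_zero_entry[OF nn])
  \<comment> \<open>At an endpoint one product is \<open>0 * \<infinity> = 0\<close>, but then the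
    other weight is 1.\<close>
  have "ereal (1 - \<theta>) * \<infinity> + ereal \<theta> * \<infinity> = \<infinity>" if "\<theta> \<in> {0..1}" for \<theta> :: real
    using that by (cases "\<theta> = 0") auto
  then show ?thesis
    by (auto simp: ereal_convex_def inf)
qed

section \<open>Rank one\<close>

lemma rank_outer:
  assumes "pos_vec \<alpha>" "pos_vec \<beta>"
  shows "rank (outer \<alpha> \<beta>) = 1"
proof -
  have row: "row r (outer \<alpha> \<beta>) = \<alpha> $ r *\<^sub>R \<beta>" for r
    by (simp add: row_def vec_eq_iff)
  have b: "\<beta> \<noteq> 0"
    using pos_vecD[OF assms(2)] by (metis less_irrefl zero_index)
  have "row undefined (outer \<alpha> \<beta>) \<noteq> 0"
    using b pos_vecD[OF assms(1), of undefined] by (simp add: row)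
  have "span (rows (outer \<alpha> \<beta>)) = span {\<beta>}"
  proof
    show "span (rows (outer \<alpha> \<beta>)) \<subseteq> span {\<beta>}"
      by (intro span_minimal) (auto simp: rows_def row span_mul span_base)
    have "inverse (\<alpha> $ undefined) *\<^sub>R row undefined (outer \<alpha> \<beta>) \<in> span (rows (outer \<alpha> \<beta>))"
      by (intro span_mul span_base) (auto simp: rows_def)
    then have "\<beta> \<in> span (rows (outer \<alpha> \<beta>))"
      using pos_vecD[OF assms(1), of undefined] by (simp add: row)
    then show "span {\<beta>} \<subseteq> span (rows (outer \<alpha> \<beta>))"
      by (intro span_minimal) auto
  qed
  then have "dim (rows (outer \<alpha> \<beta>)) = dim {\<beta>}"
    by (metis dim_span)
  also have "\<dots> = 1"
    using b dim_eq_card_independent[of "{\<beta>}"] by simp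
  finally show ?thesis
    by (simp add: row_rank_def)
qed

text \<open>Any row spans the one-dimensional row space and can serve as \<beta>. A zero of \<beta>
  would annihilate a column and a zero multiplier a row; nonnegativity then turns nonzero into
  positive.\<close>

lemma rank_1_imp_outer:
  fixes P :: "real ^ 't ^ 'r"
  assumes nn: "\<And>r t. 0 \<le> P $ r $ t" and rows: "\<And>r. row r P \<noteq> 0" and cols: "\<And>t. column t P \<noteq> 0"
    and rk: "rank P = 1"
  obtains \<alpha> \<beta> where "pos_vec \<alpha>" "pos_vec \<beta>" "P = outer \<alpha> \<beta>"
proof -
  define \<beta> where "\<beta> = row undefined P"
  have b0: "\<beta> \<noteq> 0"
    using rows by (simp add: \<beta>_def)
  have "{\<beta>} \<subseteq> rows P"
    by (auto simp: \<beta>_def rows_def)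
  then have "rows P \<subseteq> span {\<beta>}"
    using card_ge_dim_independent[of "{\<beta>}" "rows P"] b0 rk by (simp add: row_rank_def)
  then have "\<forall>r. \<exists>k. row r P = k *\<^sub>R \<beta>"
    by (auto simp: rows_def span_singleton)
  then obtain k where k: "\<And>r. row r P = k r *\<^sub>R \<beta>"
    by metis
  define \<alpha> where "\<alpha> = (\<chi> r. k r)"
  have P: "P = outer \<alpha> \<beta>"
    using k by (simp add: vec_eq_iff \<alpha>_def row_def)
  have b_nz: "\<beta> $ t \<noteq> 0" for t
    using cols[of t] unfolding P column_def by (auto simp: vec_eq_iff)
  moreover have "0 \<le> \<beta> $ t" for t
    using nn by (simp add: \<beta>_def row_def)
  ultimately have b: "pos_vec \<beta>"
    by (metis less_eq_real_def pos_vec_def)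
  have "\<alpha> $ r \<noteq> 0" for r
    using rows[of r] k by (auto simp: \<alpha>_def)
  moreover have "0 \<le> \<alpha> $ r" for r
    using nn[of r undefined] pos_vecD[OF b, of undefined] unfolding P by (simp add: zero_le_mult_iff)
  ultimately have "pos_vec \<alpha>"
    by (metis less_eq_real_def pos_vec_def)
  with b P show ?thesis
    using that by blast
qed

section \<open>Operation count\<close>

lemma fst_sum_loop:
  fixes f :: "'i \<Rightarrow> 'a::comm_monoid_add counted"
  shows "fst (sum_loop f xs s) = s + (\<Sum>i\<leftarrow>xs. fst (f i))"
  by (induction xs arbitrary: s) (simp_all add: ret_def tick_def cbind_def add.assoc)

text \<open>Each turn pays \<open>c\<close> for the summand and 1 for adding it to the
  accumulator.\<close>

lemma snd_sum_loop:
  assumes "\<And>i. snd (f i) = c"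
  shows "snd (sum_loop f xs s) = length xs * (c + 1)"
  using assms by (induction xs arbitrary: s) (simp_all add: ret_def tick_def cbind_def)

lemma fst_fill_loop:
  "fst (fill_loop f xs v) $ j = (if j \<in> set xs then fst (f j) else v $ j)"
  by (induction xs arbitrary: v) (auto simp: ret_def cbind_def)

lemma snd_fill_loop:
  assumes "\<And>i. snd (f i) = c"
  shows "snd (fill_loop f xs v) = length xs * c"
  using assms by (induction xs arbitrary: v) (simp_all add: ret_def cbind_def)

lemma length_enumerates:
  fixes xs :: "'n::finite list"
  shows "enumerates xs \<Longrightarrow> length xs = CARD('n)"
  by (auto simp: enumerates_def dest: distinct_card)

lemma set_enumerates: "enumerates xs \<Longrightarrow> set xs = UNIV"
  by (simp add: enumerates_def)

lemma sum_list_enumerates: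
  fixes f :: "'n::finite \<Rightarrow> 'a::comm_monoid_add"
  assumes "enumerates xs"
  shows "(\<Sum>i\<leftarrow>xs. f i) = (\<Sum>i\<in>UNIV. f i)"
  using assms by (metis enumerates_def sum_list_distinct_conv_sum_set)

lemma fst_alpha_prog:
  assumes "enumerates rs" "enumerates ts"
  shows "fst (alpha_prog rs ts P \<beta>) = alpha_update P \<beta>"
  using assms
  by (simp add: vec_eq_iff alpha_update_nth alpha_prog_def inverse_prog_def cbind_def tick_def
      fst_fill_loop fst_sum_loop set_enumerates sum_list_enumerates divide_inverse)

text \<open>T inverses in advance, then T products, T additions and one division for each
  row.\<close>

lemma snd_alpha_prog:
  fixes P :: "real ^ 't ^ 'r"
  assumes "enumerates rs" "enumerates ts"
  shows "snd (alpha_prog rs ts P \<beta>) = CARD('t) + CARD('r) * (2 * CARD('t) + 1)"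
  using assms
  by (simp add: alpha_prog_def inverse_prog_def cbind_def tick_def
      snd_fill_loop[where c = 1] snd_fill_loop[where c = "2 * CARD('t) + 1"]
      snd_sum_loop[where c = 1] length_enumerates)

lemma beta_prog_eq: "beta_prog rs ts P \<alpha> = alpha_prog ts rs (transpose P) \<alpha>"
  by (simp add: beta_prog_def alpha_prog_def)

lemma fst_J_prog:
  assumes "enumerates rs" "enumerates ts"
  shows "fst (J_prog rs ts P \<alpha> \<beta>) = J P \<alpha> \<beta>"
  using assms
  by (simp add: J_def J_prog_def cbind_def tick_def fst_sum_loop sum_list_enumerates)

text \<open>Four operations and one addition per entry, one addition per row, and 3 for the product
  R T, its negation and the final sum.\<close>

lemma snd_J_prog:
  fixes P :: "real ^ 't ^ 'r"
  assumes "enumerates rs" "enumerates ts"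
  shows "snd (J_prog rs ts P \<alpha> \<beta>) = CARD('r) * (5 * CARD('t) + 1) + 3"
  using assms
  by (simp add: J_prog_def cbind_def tick_def snd_sum_loop[where c = 4]
      snd_sum_loop[where c = "5 * CARD('t)"] length_enumerates)

text \<open>The constant is 20 = 9 + 3 + 2 + 6: each of R, T and 1 in the exact count is at most R
  T.\<close>

lemma snd_iteration_prog_le:
  fixes P :: "real ^ 't ^ 'r"
  assumes rs: "enumerates rs" and ts: "enumerates ts"
  shows "snd (iteration_prog rs ts P \<epsilon> \<beta> j) \<le> 20 * (CARD('r) * CARD('t))"
proof -
  have "snd (iteration_prog rs ts P \<epsilon> \<beta> j)
      = 9 * (CARD('r) * CARD('t)) + 3 * CARD('r) + 2 * CARD('t) + 6"
    using rs ts
    by (simp add: iteration_prog_def cbind_def tick_def ret_def beta_prog_eq snd_alpha_prog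
        snd_J_prog algebra_simps)
  moreover have "CARD('r) \<le> CARD('r) * CARD('t)" "CARD('t) \<le> CARD('r) * CARD('t)"
    "1 \<le> CARD('r) * CARD('t)"
    by (simp_all add: Suc_leI)
  ultimately show ?thesis by linarith
qed

section \<open>The iterates\<close>

lemma alpha_seq_0: "alpha_seq P 0 = 1"
  by (simp add: alpha_seq_def)

lemma alpha_seq_Suc: "alpha_seq P (Suc k) = alpha_update P (beta_seq P k)"
  by (simp add: alpha_seq_def beta_seq_def Let_def split_beta)

text \<open>Valid at \<open>k = 0\<close> too, since the initialization is itself a \<beta> update.
  Hence \<beta> is always a function of \<alpha>, and the columns of Q are always
  normalized.\<close>

lemma beta_seq_eq: "beta_seq P k = beta_update P (alpha_seq P k)"
  by (cases k) (simp_all add: alpha_seq_def beta_seq_def Let_def split_beta)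

lemma J_seq_0: "J_seq P 0 = \<infinity>"
  by (simp add: J_seq_def)

lemma J_seq_Suc: "J_seq P (Suc k) = J P (alpha_seq P (Suc k)) (beta_seq P (Suc k))"
  by (simp add: J_seq_def alpha_seq_def beta_seq_def Let_def split_beta)

lemma fst_iteration_prog:
  assumes "enumerates rs" "enumerates ts"
  shows "fst (iteration_prog rs ts P \<epsilon> (beta_seq P k) (J_seq P k))
    = (alpha_seq P (Suc k), beta_seq P (Suc k), J_seq P (Suc k), stops_at P \<epsilon> (Suc k))"
  using assms
  by (simp add: iteration_prog_def cbind_def tick_def ret_def beta_prog_eq fst_alpha_prog fst_J_prog
      alpha_seq_Suc beta_seq_eq[of P "Suc k"] beta_update_eq J_seq_Suc stops_at_def)

lemma iterates_pos:
  assumes "\<And>r t. 0 \<le> P $ r $ t" and "\<And>r. row r P \<noteq> 0" and "\<And>t. column t P \<noteq> 0"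
  shows "pos_vec (alpha_seq P k) \<and> pos_vec (beta_seq P k)"
proof (induction k)
  case 0
  have "pos_vec (alpha_seq P 0)"
    by (simp add: alpha_seq_0 pos_vec_def)
  then show ?case
    using assms beta_update_pos[of P] by (simp add: beta_seq_eq)
next
  case (Suc k)
  then have "pos_vec (alpha_seq P (Suc k))"
    using assms alpha_update_pos[of P] by (simp add: alpha_seq_Suc)
  then show ?case
    using assms beta_update_pos[of P] by (simp add: beta_seq_eq)
qed

lemma J_var_iterates_le:
  assumes "\<And>r t. 0 \<le> P $ r $ t" and "\<And>r. row r P \<noteq> 0" and "\<And>t. column t P \<noteq> 0"
  shows "J_var P (alpha_seq P (Suc k)) (beta_seq P (Suc k)) \<le> J_var P (alpha_seq P (Suc k)) (beta_seq P k)"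
    and "J_var P (alpha_seq P (Suc k)) (beta_seq P k) \<le> J_var P (alpha_seq P k) (beta_seq P k)"
proof -
  note pos = iterates_pos[OF assms]
  show "J_var P (alpha_seq P (Suc k)) (beta_seq P (Suc k)) \<le> J_var P (alpha_seq P (Suc k)) (beta_seq P k)"
    using pos[of k] pos[of "Suc k"]
    by (auto simp: beta_seq_eq[of P "Suc k"] intro!: J_var_beta_update_le assms(1))
  show "J_var P (alpha_seq P (Suc k)) (beta_seq P k) \<le> J_var P (alpha_seq P k) (beta_seq P k)"
    using pos[of k] pos[of "Suc k"]
    by (auto simp: alpha_seq_Suc intro!: J_var_alpha_update_le assms(1))
qed

lemma J_iterates_le:
  assumes "\<And>r t. 0 \<le> P $ r $ t" and "\<And>r. row r P \<noteq> 0" and "\<And>t. column t P \<noteq> 0"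
  shows "J P (alpha_seq P (Suc k)) (beta_seq P (Suc k)) \<le> J P (alpha_seq P (Suc k)) (beta_seq P k)"
    and "J P (alpha_seq P (Suc k)) (beta_seq P k) \<le> J P (alpha_seq P k) (beta_seq P k)"
  using J_var_iterates_le[OF assms, where k = k] iterates_pos[OF assms]
  by (auto intro!: J_mono_if_J_var_mono assms(1))

lemma decseq_J_seq:
  assumes "\<And>r t. 0 \<le> P $ r $ t" and "\<And>r. row r P \<noteq> 0" and "\<And>t. column t P \<noteq> 0"
  shows "decseq (J_seq P)"
proof (rule decseq_SucI)
  fix k
  show "J_seq P (Suc k) \<le> J_seq P k"
    using J_iterates_le[OF assms, where k = k]
    by (cases k) (auto simp: J_seq_0 J_seq_Suc)
qed

section \<open>Convergence\<close>

text \<open>Mass \<delta> can be reserved for the index \<open>j\<close>, leaving 1 - \<delta> to be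
  estimated by the extreme value. Using the same \<open>j\<close> on both sides makes the bounds
  differ by only (1 - \<delta>) (hi - lo).\<close>

lemma weighted_mean_bounds:
  fixes w p :: "'n::finite \<Rightarrow> real"
  assumes w: "(\<Sum>i\<in>UNIV. w i) = 1" "\<And>i. \<delta> \<le> w i" "0 \<le> \<delta>" and p: "\<And>i. lo \<le> p i" "\<And>i. p i \<le> hi"
  shows "\<delta> * p j + (1 - \<delta>) * lo \<le> (\<Sum>i\<in>UNIV. w i * p i)"
    and "(\<Sum>i\<in>UNIV. w i * p i) \<le> \<delta> * p j + (1 - \<delta>) * hi"
proof -
  have lower: "\<delta> * q j + (1 - \<delta>) * l \<le> (\<Sum>i\<in>UNIV. w i * q i)" if "\<And>i. l \<le> q i"
    for q :: "'n \<Rightarrow> real" and l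
  proof -
    have nn: "0 \<le> w i" for i
      using w(2)[of i] w(3) by linarith
    have "\<delta> * (q j - l) \<le> w j * (q j - l)"
      using w(2) that by (intro mult_right_mono) auto
    also have "\<dots> \<le> (\<Sum>i\<in>UNIV. w i * (q i - l))"
      using nn that by (intro member_le_sum) auto
    also have "\<dots> = (\<Sum>i\<in>UNIV. w i * q i) - l"
      by (simp add: right_diff_distrib sum_subtractf w(1) flip: sum_distrib_right)
    finally show ?thesis by (simp add: algebra_simps)
  qed
  show "\<delta> * p j + (1 - \<delta>) * lo \<le> (\<Sum>i\<in>UNIV. w i * p i)"
    by (rule lower) (rule p)
  show "(\<Sum>i\<in>UNIV. w i * p i) \<le> \<delta> * p j + (1 - \<delta>) * hi"
    using lower[of "- hi" "\<lambda>i. - p i"] p(2) by (simp add: sum_negf)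
qed

text \<open>Logarithms turn ratios into increments, which are dominated by a geometric series.
  Exponentiating the limit shows that it is positive.\<close>

lemma convergent_if_ratios_tend_to_1:
  fixes x :: "nat \<Rightarrow> real"
  assumes x: "\<And>k. 0 < x k" and lo: "0 < lo" "\<And>k. lo \<le> x (Suc k) / x k"
    and \<rho>: "0 \<le> \<rho>" "\<rho> < 1" and near: "\<And>k. \<bar>x (Suc k) / x k - 1\<bar> \<le> C * \<rho> ^ k"
  shows "\<exists>l>0. x \<longlonglongrightarrow> l"
proof -
  have bound: "\<bar>ln (x (Suc k)) - ln (x k)\<bar> \<le> (C / min lo 1) * \<rho> ^ k" for k
  proof -
    define q where "q = x (Suc k) / x k"
    have q: "0 < q" "lo \<le> q"
      using x lo by (auto simp: q_def)
    \<comment> \<open>Capping \<open>lo\<close> at 1 gives one denominator for both estimates: at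
      most 1 for bounding \<open>ln q\<close>, at most \<open>q\<close> for bounding
      \<open>- ln q\<close>.\<close>
    have m: "0 < min lo 1" "min lo 1 \<le> q" "min lo 1 \<le> 1"
      using lo(1) q by auto
    have "ln q \<le> q - 1"
      using q by (intro ln_le_minus_one)
    also have "\<dots> \<le> \<bar>q - 1\<bar> / min lo 1"
    proof -
      have "\<bar>q - 1\<bar> * min lo 1 \<le> \<bar>q - 1\<bar> * 1"
        using m by (intro mult_left_mono) auto
      then have "\<bar>q - 1\<bar> \<le> \<bar>q - 1\<bar> / min lo 1"
        using m by (simp add: pos_le_divide_eq)
      then show ?thesis by linarith
    qed
    finally have u: "ln q \<le> \<bar>q - 1\<bar> / min lo 1" .
    have "- ln q \<le> 1 / q - 1"
      using ln_le_minus_one[of "1 / q"] q by (simp add: ln_divide_pos)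
    also have "1 / q - 1 = (1 - q) / q"
      using q by (simp add: field_simps)
    also have "\<dots> \<le> \<bar>q - 1\<bar> / q"
      using q by (intro divide_right_mono) auto
    also have "\<dots> \<le> \<bar>q - 1\<bar> / min lo 1"
      using m q by (intro divide_left_mono) auto
    finally have "\<bar>ln q\<bar> \<le> \<bar>q - 1\<bar> / min lo 1"
      using u by linarith
    also have "\<dots> \<le> C * \<rho> ^ k / min lo 1"
      using near[of k] m by (intro divide_right_mono) (auto simp: q_def)
    finally show ?thesis
      using x by (simp add: q_def ln_divide_pos)
  qed
  have geometric: "summable (\<lambda>k. (C / min lo 1) * \<rho> ^ k)"
    using \<rho> by (simp add: summable_mult summable_geometric)
  have "summable (\<lambda>k. ln (x (Suc k)) - ln (x k))"
    by (rule summable_comparison_test'[OF geometric, of 0]) (simp only: real_norm_def bound)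
  then obtain s where "(\<lambda>n. \<Sum>k<n. ln (x (Suc k)) - ln (x k)) \<longlonglongrightarrow> s"
    using summable_LIMSEQ by blast
  then have "(\<lambda>n. ln (x n) - ln (x 0)) \<longlonglongrightarrow> s"
    using sum_lessThan_telescope[of "\<lambda>n. ln (x n)"] by simp
  from tendsto_add[OF this tendsto_const[of "ln (x 0)"]]
  have "(\<lambda>n. exp (ln (x n))) \<longlonglongrightarrow> exp (s + ln (x 0))"
    by (intro tendsto_exp) simp
  then have "x \<longlonglongrightarrow> exp (s + ln (x 0))"
    using x by simp
  then show ?thesis
    using exp_gt_zero by blast
qed

text \<open>The new \<beta> lies between m S and M S, and the new \<alpha> is at most M / (m S). In
  their product the scale S cancels, so the bound is uniform over all iterates.\<close>

lemma alpha_update_weight_lower_bound: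
  fixes P :: "real ^ 't ^ 'r"
  assumes m: "0 < m" "\<And>r t. m \<le> P $ r $ t" and M: "\<And>r t. P $ r $ t \<le> M" and a: "pos_vec \<alpha>"
  shows "m\<^sup>2 / (real CARD('t) * M\<^sup>2) \<le> P $ r $ t /
    (real CARD('t) * alpha_update P (beta_update P \<alpha>) $ r * beta_update P \<alpha> $ t)"
proof -
  define S where "S = (\<Sum>r\<in>UNIV. 1 / \<alpha> $ r) / real CARD('r)"
  define b where "b = beta_update P \<alpha>"
  define a' where "a' = alpha_update P b"
  have S: "0 < S"
    unfolding S_def using pos_vecD[OF a] by (simp add: sum_pos)
  have M0: "0 < M"
    using m(1) m(2)[of r t] M[of r t] by linarith
  have b_eq: "b $ s = (\<Sum>r\<in>UNIV. P $ r $ s * (1 / \<alpha> $ r)) / real CARD('r)" for s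
    by (simp add: b_def beta_update_eq alpha_update_nth)
  have b_lo: "m * S \<le> b $ s" for s
  proof -
    have "(\<Sum>r\<in>UNIV. m * (1 / \<alpha> $ r)) \<le> (\<Sum>r\<in>UNIV. P $ r $ s * (1 / \<alpha> $ r))"
      using m(2) pos_vecD[OF a] by (intro sum_mono mult_right_mono) (auto simp: less_imp_le)
    then show ?thesis
      unfolding b_eq S_def sum_distrib_left[symmetric] by (simp add: divide_right_mono)
  qed
  have b_hi: "b $ s \<le> M * S" for s
  proof -
    have "(\<Sum>r\<in>UNIV. P $ r $ s * (1 / \<alpha> $ r)) \<le> (\<Sum>r\<in>UNIV. M * (1 / \<alpha> $ r))"
      using M pos_vecD[OF a] by (intro sum_mono mult_right_mono) (auto simp: less_imp_le)
    then show ?thesis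
      unfolding b_eq S_def sum_distrib_left[symmetric] by (simp add: divide_right_mono)
  qed
  have mS: "0 < m * S"
    using m(1) S by simp
  have b_pos: "0 < b $ s" for s
    using b_lo[of s] mS by linarith
  have "(\<Sum>s\<in>UNIV. P $ r $ s / b $ s) \<le> (\<Sum>s\<in>(UNIV :: 't set). M / (m * S))"
    using M b_lo b_pos mS M0 by (intro sum_mono frac_le) auto
  then have a'_hi: "a' $ r \<le> M / (m * S)"
    unfolding a'_def alpha_update_nth by (simp add: pos_divide_le_eq mult.commute)
  have "0 < P $ r $ s / b $ s" for s
    using m(1) m(2)[of r s] b_pos[of s] by simp
  then have a'_pos: "0 < a' $ r"
    unfolding a'_def alpha_update_nth by (simp add: sum_pos)
  have "m\<^sup>2 / (real CARD('t) * M\<^sup>2) = m / (real CARD('t) * (M / (m * S)) * (M * S))"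
    using S m(1) by (simp add: power2_eq_square)
  also have "\<dots> \<le> P $ r $ t / (real CARD('t) * a' $ r * b $ t)"
  proof (rule frac_le)
    show "real CARD('t) * a' $ r * b $ t \<le> real CARD('t) * (M / (m * S)) * (M * S)"
      using a'_hi a'_pos b_hi b_pos M0 m(1) S less_imp_le[OF b_pos]
      by (intro mult_mono mult_left_mono mult_nonneg_nonneg divide_nonneg_nonneg) auto
    show "0 < real CARD('t) * a' $ r * b $ t"
      using a'_pos b_pos by simp
  qed (use m(1) m(2)[of r t] in auto)
  finally show ?thesis
    by (simp add: a'_def b_def)
qed

text \<open>The ratios of successive iterates are averages of the previous ratios, with weights bounded
  below, so that the interval containing them shrinks geometrically.\<close>

lemma ratio_interval:
  fixes P :: "real ^ 't ^ 'r"
  assumes P: "\<And>r t. 0 < P $ r $ t" and pos: "\<And>k. pos_vec (alpha_seq P k) \<and> pos_vec (beta_seq P k)"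
    and \<delta>: "0 \<le> \<delta>" "\<delta> \<le> 1"
      "\<And>r t k. \<delta> \<le> P $ r $ t / (real CARD('t) * alpha_seq P (Suc k) $ r * beta_seq P k $ t)"
    and init: "0 < L" "\<And>r. L \<le> alpha_seq P 1 $ r" "\<And>r. alpha_seq P 1 $ r \<le> H"
  shows "\<exists>lo hi. L \<le> lo \<and> hi \<le> H \<and> hi - lo \<le> (1 - \<delta>) ^ k * (H - L) \<and>
    (\<forall>r. lo \<le> alpha_seq P (Suc k) $ r / alpha_seq P k $ r \<and>
         alpha_seq P (Suc k) $ r / alpha_seq P k $ r \<le> hi)"
proof (induction k)
  case 0
  \<comment> \<open>Since \<alpha> starts at the all-ones vector, the first ratios are the entries
    of the first iterate.\<close>
  then show ?case
    using init by (intro exI[of _ L] exI[of _ H]) (simp add: alpha_seq_0)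
next
  case (Suc k)
  then obtain lo hi where IH: "L \<le> lo" "hi \<le> H" "hi - lo \<le> (1 - \<delta>) ^ k * (H - L)"
    "\<And>r. lo \<le> alpha_seq P (Suc k) $ r / alpha_seq P k $ r"
    "\<And>r. alpha_seq P (Suc k) $ r / alpha_seq P k $ r \<le> hi"
    by blast
  have a: "0 < alpha_seq P j $ r" and b: "0 < beta_seq P j $ t" for j r t
    using pos by (auto simp: pos_vec_def)
  have lo: "0 < lo"
    using IH(1) init(1) by linarith
  \<comment> \<open>\<open>p\<close> is the old-to-new ratio of \<beta>. Its reciprocal averages the
    reciprocal ratios of \<alpha>, with weights given by the normalized columns of Q.\<close>
  define p where "p t = beta_seq P k $ t / beta_seq P (Suc k) $ t" for t
  have p: "lo \<le> p t \<and> p t \<le> hi" for t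
  proof -
    define w where "w r = P $ r $ t / (alpha_seq P k $ r * beta_seq P k $ t) / real CARD('r)" for r
    define q where "q r = alpha_seq P k $ r / alpha_seq P (Suc k) $ r" for r
    have w: "(\<Sum>r\<in>UNIV. w r) = 1"
      using beta_update_col_sums[of P "alpha_seq P k" t] pos[of k]
      unfolding w_def sum_divide_distrib[symmetric] by (simp add: beta_seq_eq)
    have w0: "0 \<le> w r" for r
      using P[of r t] a[of k r] b[of k t] by (simp add: w_def less_imp_le)
    have hi: "0 < hi"
      using IH(4,5)[of undefined] lo by linarith
    have q: "1 / hi \<le> q r" "q r \<le> 1 / lo" for r
      using IH(4,5)[of r] a[of k r] a[of "Suc k" r] lo hi by (simp_all add: q_def field_simps)
    have "1 / p t = (\<Sum>r\<in>UNIV. P $ r $ t / alpha_seq P (Suc k) $ r) / (real CARD('r) * beta_seq P k $ t)"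
      unfolding p_def beta_seq_eq[of P "Suc k"] beta_update_eq by (simp add: alpha_update_nth)
    also have "\<dots> = (\<Sum>r\<in>UNIV. w r * q r)"
      unfolding sum_divide_distrib
    proof (rule sum.cong)
      fix r
      show "P $ r $ t / alpha_seq P (Suc k) $ r / (real CARD('r) * beta_seq P k $ t) = w r * q r"
        using a[of k r] by (simp add: w_def q_def)
    qed simp
    finally have "1 / p t = (\<Sum>r\<in>UNIV. w r * q r)" .
    \<comment> \<open>Taking \<delta> = 0 here: this half-step only preserves the interval; the
      shrinking comes from the \<alpha> half-step.\<close>
    then have "1 / hi \<le> 1 / p t" "1 / p t \<le> 1 / lo"
      using weighted_mean_bounds[of w 0 "1 / hi" q "1 / lo"] w w0 q by auto
    moreover have "0 < p t"
      using b by (simp add: p_def)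
    ultimately show ?thesis
      using lo hi by (simp add: field_simps)
  qed
  \<comment> \<open>One arbitrary column, shared by both bounds and by all rows; a choice depending
    on \<open>r\<close> would not bound the spread between different rows.\<close>
  define s :: 't where "s = undefined"
  define lo' where "lo' = \<delta> * p s + (1 - \<delta>) * lo"
  define hi' where "hi' = \<delta> * p s + (1 - \<delta>) * hi"
  have "lo' \<le> alpha_seq P (Suc (Suc k)) $ r / alpha_seq P (Suc k) $ r \<and>
      alpha_seq P (Suc (Suc k)) $ r / alpha_seq P (Suc k) $ r \<le> hi'" for r
  proof -
    define w where "w t = P $ r $ t / (real CARD('t) * alpha_seq P (Suc k) $ r * beta_seq P k $ t)" for t
    have w: "(\<Sum>t\<in>UNIV. w t) = 1"
    proof -
      have "(\<Sum>t\<in>UNIV. w t) = (\<Sum>t\<in>UNIV. P $ r $ t / (alpha_seq P (Suc k) $ r * beta_seq P k $ t)) / real CARD('t)"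
        unfolding sum_divide_distrib by (simp add: w_def ac_simps)
      then show ?thesis
        using alpha_update_row_sums[of P "beta_seq P k" r] pos[of "Suc k"]
        by (simp add: alpha_seq_Suc)
    qed
    have "alpha_seq P (Suc (Suc k)) $ r / alpha_seq P (Suc k) $ r
        = (\<Sum>t\<in>UNIV. P $ r $ t / beta_seq P (Suc k) $ t) / (real CARD('t) * alpha_seq P (Suc k) $ r)"
      unfolding alpha_seq_Suc[of P "Suc k"] by (simp add: alpha_update_nth)
    also have "\<dots> = (\<Sum>t\<in>UNIV. w t * p t)"
      unfolding sum_divide_distrib
    proof (rule sum.cong)
      fix t
      show "P $ r $ t / beta_seq P (Suc k) $ t / (real CARD('t) * alpha_seq P (Suc k) $ r) = w t * p t"
        using b[of k t] by (simp add: w_def p_def)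
    qed simp
    finally have "alpha_seq P (Suc (Suc k)) $ r / alpha_seq P (Suc k) $ r = (\<Sum>t\<in>UNIV. w t * p t)" .
    then show ?thesis
      using weighted_mean_bounds[of w \<delta> lo p hi s] w \<delta>(1) \<delta>(3)[of r _ k] p
      by (simp add: lo'_def hi'_def w_def)
  qed
  moreover have "L \<le> lo'"
  proof -
    have "lo' = lo + \<delta> * (p s - lo)" by (simp add: lo'_def algebra_simps)
    then show ?thesis using p[of s] \<delta>(1) IH(1) by (simp add: add_increasing2)
  qed
  moreover have "hi' \<le> H"
  proof -
    have "hi' = hi - \<delta> * (hi - p s)" by (simp add: hi'_def algebra_simps)
    moreover have "0 \<le> \<delta> * (hi - p s)" using p[of s] \<delta>(1) by simp
    ultimately show ?thesis using IH(2) by linarith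
  qed
  moreover have "hi' - lo' \<le> (1 - \<delta>) ^ Suc k * (H - L)"
  proof -
    have "hi' - lo' = (1 - \<delta>) * (hi - lo)" by (simp add: hi'_def lo'_def algebra_simps)
    also have "\<dots> \<le> (1 - \<delta>) * ((1 - \<delta>) ^ k * (H - L))"
      using IH(3) \<delta>(2) by (intro mult_left_mono) auto
    finally show ?thesis by (simp add: mult.assoc)
  qed
  ultimately show ?case by blast
qed

text \<open>After exchanging the sums, each of the T columns of Q contributes R / T.\<close>

lemma alpha_seq_ratio_sum:
  fixes P :: "real ^ 't ^ 'r"
  assumes "pos_vec (beta_seq P k)"
  shows "(\<Sum>r\<in>UNIV. alpha_seq P (Suc k) $ r / alpha_seq P k $ r) = real CARD('r)"
proof -
  have "(\<Sum>r\<in>UNIV. alpha_seq P (Suc k) $ r / alpha_seq P k $ r)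
      = (\<Sum>r\<in>UNIV. \<Sum>t\<in>UNIV. P $ r $ t / (alpha_seq P k $ r * beta_seq P k $ t) / real CARD('t))"
    by (simp add: alpha_seq_Suc alpha_update_nth sum_divide_distrib ac_simps)
  also have "\<dots> = (\<Sum>t\<in>UNIV. (\<Sum>r\<in>UNIV. P $ r $ t / (alpha_seq P k $ r * beta_seq P k $ t)) / real CARD('t))"
    by (subst sum.swap) (simp add: sum_divide_distrib)
  also have "\<dots> = real CARD('r)"
    using beta_update_col_sums[of P "alpha_seq P k"] assms by (simp add: beta_seq_eq)
  finally show ?thesis .
qed

lemma alpha_seq_convergent:
  fixes P :: "real ^ 't ^ 'r"
  assumes P: "\<And>r t. 0 < P $ r $ t" and pos: "\<And>k. pos_vec (alpha_seq P k) \<and> pos_vec (beta_seq P k)"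
  obtains \<alpha>s where "pos_vec \<alpha>s" "alpha_seq P \<longlonglongrightarrow> \<alpha>s"
proof -
  define A where "A = range (\<lambda>(r, t). P $ r $ t)"
  define m where "m = Min A"
  define M where "M = Max A"
  have A: "finite A" "A \<noteq> {}" "P $ r $ t \<in> A" for r t
    by (auto simp: A_def)
  have m: "0 < m" "m \<le> P $ r $ t" and M: "P $ r $ t \<le> M" for r t
    using A P by (auto simp: m_def M_def A_def)
  define \<delta> where "\<delta> = m\<^sup>2 / (real CARD('t) * M\<^sup>2)"
  have "m \<le> M"
    using m(2) M by (meson order_trans)
  then have \<delta>: "0 < \<delta>" "\<delta> \<le> 1"
  proof -
    show "0 < \<delta>" using m(1) \<open>m \<le> M\<close> by (simp add: \<delta>_def)
    have "1 * m\<^sup>2 \<le> real CARD('t) * M\<^sup>2"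
      using m(1) \<open>m \<le> M\<close> by (intro mult_mono power_mono) (auto simp: Suc_leI)
    then show "\<delta> \<le> 1" using m(1) \<open>m \<le> M\<close> by (simp add: \<delta>_def)
  qed
  have weight: "\<delta> \<le> P $ r $ t / (real CARD('t) * alpha_seq P (Suc k) $ r * beta_seq P k $ t)" for r t k
    using alpha_update_weight_lower_bound[OF m M, of "alpha_seq P k"] pos[of k]
    by (simp add: \<delta>_def alpha_seq_Suc beta_seq_eq)
  define L where "L = Min (range (\<lambda>r. alpha_seq P 1 $ r))"
  define H where "H = Max (range (\<lambda>r. alpha_seq P 1 $ r))"
  have LH: "0 < L" "L \<le> alpha_seq P 1 $ r" "alpha_seq P 1 $ r \<le> H" for r
    using pos[of 1] by (auto simp: L_def H_def pos_vec_def)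
  have ratio: "L \<le> alpha_seq P (Suc k) $ r / alpha_seq P k $ r \<and>
      \<bar>alpha_seq P (Suc k) $ r / alpha_seq P k $ r - 1\<bar> \<le> (H - L) * (1 - \<delta>) ^ k" for k r
  proof -
    obtain lo hi where *: "L \<le> lo" "hi - lo \<le> (1 - \<delta>) ^ k * (H - L)"
      "\<And>r. lo \<le> alpha_seq P (Suc k) $ r / alpha_seq P k $ r"
      "\<And>r. alpha_seq P (Suc k) $ r / alpha_seq P k $ r \<le> hi"
      using ratio_interval[OF P pos less_imp_le[OF \<delta>(1)] \<delta>(2) weight LH, of k] by blast
    have sum: "(\<Sum>r\<in>UNIV. alpha_seq P (Suc k) $ r / alpha_seq P k $ r) = real CARD('r)"
      using alpha_seq_ratio_sum pos by blast
    \<comment> \<open>The mean 1 lies in the interval, so every ratio is within hi - lo of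
      1.\<close>
    have "(\<Sum>r\<in>(UNIV :: 'r set). lo) \<le> (\<Sum>r\<in>UNIV. alpha_seq P (Suc k) $ r / alpha_seq P k $ r)"
      by (intro sum_mono *(3))
    then have "lo \<le> 1"
      unfolding sum by simp
    moreover have "(\<Sum>r\<in>UNIV. alpha_seq P (Suc k) $ r / alpha_seq P k $ r) \<le> (\<Sum>r\<in>(UNIV :: 'r set). hi)"
      by (intro sum_mono *(4))
    then have "1 \<le> hi"
      unfolding sum by simp
    ultimately show ?thesis
      using *(1,2) *(3,4)[of r] by (auto simp: abs_le_iff mult.commute)
  qed
  have "\<exists>l>0. (\<lambda>k. alpha_seq P k $ r) \<longlonglongrightarrow> l" for r
  proof (rule convergent_if_ratios_tend_to_1)
    show "0 < alpha_seq P k $ r" for k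
      using pos[of k] by (simp add: pos_vec_def)
    show "L \<le> alpha_seq P (Suc k) $ r / alpha_seq P k $ r" for k
      using ratio by blast
    show "\<bar>alpha_seq P (Suc k) $ r / alpha_seq P k $ r - 1\<bar> \<le> (H - L) * (1 - \<delta>) ^ k" for k
      using ratio by blast
  qed (use LH \<delta> in auto)
  then obtain l where l: "\<And>r. 0 < l r" "\<And>r. (\<lambda>k. alpha_seq P k $ r) \<longlonglongrightarrow> l r"
    by metis
  show ?thesis
  proof
    show "pos_vec (\<chi> r. l r)"
      using l by (simp add: pos_vec_def)
    show "alpha_seq P \<longlonglongrightarrow> (\<chi> r. l r)"
      using l by (intro vec_tendstoI) simp
  qed
qed

section \<open>Continuity of the updates and passage to the limit\<close>

lemma tendsto_alpha_update:
  assumes f: "f \<longlonglongrightarrow> \<beta>" and b: "pos_vec \<beta>"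
  shows "(\<lambda>k. alpha_update P (f k)) \<longlonglongrightarrow> alpha_update P \<beta>"
proof (rule vec_tendstoI)
  have "\<beta> $ t \<noteq> 0" for t
    using pos_vecD[OF b] by (metis less_irrefl)
  then show "(\<lambda>k. alpha_update P (f k) $ r) \<longlonglongrightarrow> alpha_update P \<beta> $ r" for r
    unfolding alpha_update_nth by (intro tendsto_intros f) auto
qed

lemma tendsto_J_var:
  assumes "f \<longlonglongrightarrow> \<alpha>" "pos_vec \<alpha>" "g \<longlonglongrightarrow> \<beta>" "pos_vec \<beta>"
  shows "(\<lambda>k. J_var P (f k) (g k)) \<longlonglongrightarrow> J_var P \<alpha> \<beta>"
proof -
  have "\<alpha> $ r \<noteq> 0" "\<beta> $ t \<noteq> 0" for r t
    using pos_vecD[OF assms(2)] pos_vecD[OF assms(4)] by (metis less_irrefl)+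
  then show ?thesis
    unfolding J_var_def by (intro tendsto_intros assms) auto
qed

lemma positive_matrix_nonzero:
  fixes P :: "real ^ 't ^ 'r"
  assumes P: "\<And>r t. 0 < P $ r $ t"
  shows "row r P \<noteq> 0" "column t P \<noteq> 0"
proof -
  have "row r P $ undefined \<noteq> 0" "column t P $ undefined \<noteq> 0"
    using P[of r undefined] P[of undefined t] by (simp_all add: row_def column_def)
  then show "row r P \<noteq> 0" "column t P \<noteq> 0"
    by auto
qed

text \<open>Convergence of \<alpha> suffices: \<beta> depends continuously on it, and the limit of
  the recursion is the fixed-point equation.\<close>

lemma iterates_converge:
  fixes P :: "real ^ 't ^ 'r"
  assumes P: "\<And>r t. 0 < P $ r $ t" and pos: "\<And>k. pos_vec (alpha_seq P k) \<and> pos_vec (beta_seq P k)"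
  obtains \<alpha>s \<beta>s where "alpha_seq P \<longlonglongrightarrow> \<alpha>s" "beta_seq P \<longlonglongrightarrow> \<beta>s" "stationary_point P \<alpha>s \<beta>s"
proof -
  obtain \<alpha>s where \<alpha>s: "pos_vec \<alpha>s" "alpha_seq P \<longlonglongrightarrow> \<alpha>s"
    using alpha_seq_convergent[OF P pos] .
  define \<beta>s where "\<beta>s = beta_update P \<alpha>s"
  have lim_b: "beta_seq P \<longlonglongrightarrow> \<beta>s"
    using tendsto_alpha_update[OF \<alpha>s(2,1), of "transpose P"]
    by (simp add: \<beta>s_def beta_seq_eq[abs_def] beta_update_eq)
  have nz: "row r P \<noteq> 0" "column t P \<noteq> 0" for r t
    using positive_matrix_nonzero[OF P] by blast+
  have b_pos: "pos_vec \<beta>s"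
    unfolding \<beta>s_def by (rule beta_update_pos[OF less_imp_le[OF P] nz(2) \<alpha>s(1)])
  have "(\<lambda>k. alpha_seq P (Suc k)) \<longlonglongrightarrow> alpha_update P \<beta>s"
    using tendsto_alpha_update[OF lim_b b_pos] by (simp add: alpha_seq_Suc)
  then have "\<alpha>s = alpha_update P \<beta>s"
    using LIMSEQ_Suc[OF \<alpha>s(2)] LIMSEQ_unique by blast
  then have "stationary_point P \<alpha>s \<beta>s"
    using stationary_point_iff_updates[OF P] \<alpha>s(1) b_pos \<beta>s_def by blast
  with \<alpha>s(2) lim_b show ?thesis
    using that by blast
qed

text \<open>From the second iteration on, both compared values are finite and their common constant
  cancels.\<close>

lemma stops_at_Suc_Suc:
  assumes P: "\<And>r t. 0 < P $ r $ t" and pos: "\<And>k. pos_vec (alpha_seq P k) \<and> pos_vec (beta_seq P k)"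
  shows "stops_at P \<epsilon> (Suc (Suc k)) \<longleftrightarrow> \<bar>J_var P (alpha_seq P (Suc k)) (beta_seq P (Suc k)) -
    J_var P (alpha_seq P (Suc (Suc k))) (beta_seq P (Suc (Suc k)))\<bar> < \<epsilon>"
  using pos by (simp add: stops_at_def J_seq_Suc J_eq_J_var P)

text \<open>The first comparison is with the start value \<infinity>.\<close>

lemma not_stops_at_1:
  assumes P: "\<And>r t. 0 < P $ r $ t" and pos: "\<And>k. pos_vec (alpha_seq P k) \<and> pos_vec (beta_seq P k)"
  shows "\<not> stops_at P \<epsilon> (Suc 0)"
  using pos[of 1] by (simp add: stops_at_def J_seq_Suc J_seq_0 J_eq_J_var P)

lemma stops_at_exists:
  assumes P: "\<And>r t. 0 < P $ r $ t" and pos: "\<And>k. pos_vec (alpha_seq P k) \<and> pos_vec (beta_seq P k)"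
    and \<epsilon>: "0 < \<epsilon>"
  shows "\<exists>\<kappa>. stops_at P \<epsilon> \<kappa>"
proof -
  obtain \<alpha>s \<beta>s where lim: "alpha_seq P \<longlonglongrightarrow> \<alpha>s" "beta_seq P \<longlonglongrightarrow> \<beta>s" "stationary_point P \<alpha>s \<beta>s"
    using iterates_converge[OF P pos] .
  define j where "j k = J_var P (alpha_seq P k) (beta_seq P k)" for k
  have "j \<longlonglongrightarrow> J_var P \<alpha>s \<beta>s"
    unfolding j_def using lim by (intro tendsto_J_var) (auto simp: stationary_point_def)
  then have "(\<lambda>k. j (Suc k) - j (Suc (Suc k))) \<longlonglongrightarrow> J_var P \<alpha>s \<beta>s - J_var P \<alpha>s \<beta>s"
    by (intro tendsto_diff LIMSEQ_Suc)
  then have "\<forall>\<^sub>F k in sequentially. \<bar>j (Suc k) - j (Suc (Suc k))\<bar> < \<epsilon>"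
    using \<epsilon> by (auto simp: tendsto_iff dist_real_def)
  then obtain k where "\<bar>j (Suc k) - j (Suc (Suc k))\<bar> < \<epsilon>"
    by (meson eventually_happens' sequentially_bot)
  then show ?thesis
    using stops_at_Suc_Suc[OF P pos] by (auto simp: j_def)
qed

text \<open>A tie forces equality in the \<alpha> half-step. There \<beta> is the same on both
  sides, so uniqueness of the product already fixes \<alpha>, and \<beta> follows from
  \<alpha>.\<close>

lemma iterates_constant_after_tie:
  assumes P: "\<And>r t. 0 < P $ r $ t" and pos: "\<And>k. pos_vec (alpha_seq P k) \<and> pos_vec (beta_seq P k)"
    and tie: "J_var P (alpha_seq P (Suc k)) (beta_seq P (Suc k)) = J_var P (alpha_seq P k) (beta_seq P k)"
  shows "alpha_seq P (k + n) = alpha_seq P k \<and> beta_seq P (k + n) = beta_seq P k"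
proof -
  have nn: "0 \<le> P $ r $ t" and nz: "row r P \<noteq> 0" "column t P \<noteq> 0" for r t
    using positive_matrix_nonzero[OF P] P by (auto simp: less_imp_le)
  have "J_var P (alpha_seq P (Suc k)) (beta_seq P k) = J_var P (alpha_seq P k) (beta_seq P k)"
    using J_var_iterates_le[OF nn nz, of k] tie by linarith
  then have outer: "outer (alpha_seq P k) (beta_seq P k) = outer (alpha_seq P (Suc k)) (beta_seq P k)"
    using pos[of k] pos[of "Suc k"] alpha_update_row_sums[of P "beta_seq P k"] P
    by (intro J_var_minimal(2)[OF nn]) (auto simp: alpha_seq_Suc)
  have "alpha_seq P k $ r = alpha_seq P (Suc k) $ r" for r
    using arg_cong[OF outer, of "\<lambda>A. A $ r $ undefined"] pos[of k]
    by (auto simp: pos_vec_def dest: spec[of _ undefined])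
  then have fix_a: "alpha_seq P (Suc k) = alpha_seq P k"
    by (simp add: vec_eq_iff)
  have "alpha_seq P (k + n) = alpha_seq P k"
    using fix_a by (induction n) (simp_all add: alpha_seq_Suc beta_seq_eq)
  then show ?thesis
    by (simp add: beta_seq_eq)
qed

text \<open>As \<open>\<epsilon>\<close> shrinks, the stopping index either tends to infinity or stays at an index where the
  objective did not change at all; there the iteration has already reached its limit.\<close>

lemma algorithm_output_tendsto:
  fixes P :: "real ^ 't ^ 'r"
  assumes P: "\<And>r t. 0 < P $ r $ t" and pos: "\<And>k. pos_vec (alpha_seq P k) \<and> pos_vec (beta_seq P k)"
    and lim: "alpha_seq P \<longlonglongrightarrow> \<alpha>s" "beta_seq P \<longlonglongrightarrow> \<beta>s"
  shows "(algorithm_output P \<longlongrightarrow> outer \<alpha>s \<beta>s) (at_right 0)"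
proof (rule tendstoI)
  fix e :: real
  assume e: "0 < e"
  define out where "out k = outer (alpha_seq P k) (beta_seq P k)" for k
  define j where "j k = J_var P (alpha_seq P k) (beta_seq P k)" for k
  have "out \<longlonglongrightarrow> outer \<alpha>s \<beta>s"
    unfolding out_def by (intro vec_tendstoI) (auto intro!: tendsto_intros lim)
  then obtain N where N: "\<And>k. N \<le> k \<Longrightarrow> dist (out k) (outer \<alpha>s \<beta>s) < e"
    using e unfolding tendsto_iff eventually_sequentially by blast
  have tie: "out (Suc (Suc k)) = outer \<alpha>s \<beta>s" if "j (Suc k) = j (Suc (Suc k))" for k
  proof -
    have const: "alpha_seq P (Suc k + n) = alpha_seq P (Suc k) \<and> beta_seq P (Suc k + n) = beta_seq P (Suc k)" for n
      using iterates_constant_after_tie[OF P pos, of "Suc k" n] that by (simp add: j_def)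
    have "(\<lambda>n. alpha_seq P (n + Suc k)) \<longlonglongrightarrow> \<alpha>s" "(\<lambda>n. beta_seq P (n + Suc k)) \<longlonglongrightarrow> \<beta>s"
      using lim by (intro LIMSEQ_ignore_initial_segment; simp)+
    then have "alpha_seq P (Suc k) = \<alpha>s" "beta_seq P (Suc k) = \<beta>s"
      using const by (simp_all add: add.commute LIMSEQ_const_iff)
    then show ?thesis
      using const[of 1] by (simp add: out_def)
  qed
  have "\<forall>\<^sub>F \<epsilon> in at_right 0. stops_at P \<epsilon> k \<longrightarrow> out k = outer \<alpha>s \<beta>s" for k
  proof (cases "\<exists>i. k = Suc (Suc i)")
    case True
    then obtain i where k: "k = Suc (Suc i)" by blast
    show ?thesis
    proof (cases "j (Suc i) = j (Suc (Suc i))")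
      case True
      then show ?thesis by (simp add: k tie)
    next
      \<comment> \<open>A nonzero gap excludes stopping at this index once \<epsilon> is below the
        gap.\<close>
      case False
      have "\<forall>\<^sub>F \<epsilon> in at_right 0. \<epsilon> < \<bar>j (Suc i) - j (Suc (Suc i))\<bar>"
        using False by (intro eventually_at_right_real[THEN eventually_mono]) auto
      then show ?thesis
        by eventually_elim (simp add: k stops_at_Suc_Suc[OF P pos] j_def)
    qed
  next
    case False
    then have "k = 0 \<or> k = Suc 0" by (metis not0_implies_Suc)
    then have "\<not> stops_at P \<epsilon> k" for \<epsilon>
      using not_stops_at_1[OF P pos] by (auto simp: stops_at_def)
    then show ?thesis by simp
  qed
  \<comment> \<open>Only the finitely many indices below \<open>N\<close> need small \<epsilon>;
    later iterates are close to the limit anyway.\<close>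
  then have "\<forall>\<^sub>F \<epsilon> in at_right 0. \<forall>k\<in>{..<N}. stops_at P \<epsilon> k \<longrightarrow> out k = outer \<alpha>s \<beta>s"
    by (intro eventually_ball_finite) auto
  moreover have "\<forall>\<^sub>F \<epsilon> in at_right (0 :: real). 0 < \<epsilon>"
    by (rule eventually_at_right_less)
  ultimately show "\<forall>\<^sub>F \<epsilon> in at_right 0. dist (algorithm_output P \<epsilon>) (outer \<alpha>s \<beta>s) < e"
  proof eventually_elim
    case (elim \<epsilon>)
    define \<kappa> where "\<kappa> = (LEAST \<kappa>. stops_at P \<epsilon> \<kappa>)"
    have "stops_at P \<epsilon> \<kappa>"
      unfolding \<kappa>_def using stops_at_exists[OF P pos elim(2)] by (rule LeastI_ex)
    then have "dist (out \<kappa>) (outer \<alpha>s \<beta>s) < e"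
      using elim(1) N e by (cases "\<kappa> < N") auto
    then show ?case
      by (simp add: algorithm_output_def \<kappa>_def out_def Let_def)
  qed
qed

section \<open>Zero optimal value and rank one\<close>

lemma global_minimizer_J_eq_0_iff:
  fixes P :: "real ^ 't ^ 'r"
  assumes P: "\<And>r t. 0 < P $ r $ t" and pos: "pos_vec \<alpha>" "pos_vec \<beta>" and m: "global_minimizer P \<alpha> \<beta>"
  shows "J P \<alpha> \<beta> = 0 \<longleftrightarrow> rank P = 1"
proof
  assume "J P \<alpha> \<beta> = 0"
  then show "rank P = 1"
    using J_eq_0_iff[OF P pos] rank_outer[OF pos] by simp
next
  assume rk: "rank P = 1"
  have nn: "0 \<le> P $ r $ t" and nz: "row r P \<noteq> 0" "column t P \<noteq> 0" for r t
    using positive_matrix_nonzero[OF P] P by (auto simp: less_imp_le)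
  obtain \<alpha>' \<beta>' where *: "pos_vec \<alpha>'" "pos_vec \<beta>'" "P = outer \<alpha>' \<beta>'"
    using rank_1_imp_outer[OF nn nz rk] .
  then have "J P \<alpha>' \<beta>' = 0"
    using J_eq_0_iff[OF P] by blast
  then have "J P \<alpha> \<beta> \<le> 0"
    using m *(1,2) nonneg_if_pos_vec unfolding global_minimizer_def by metis
  then show "J P \<alpha> \<beta> = 0"
    using J_nonneg[OF nn nonneg_if_pos_vec[OF pos(1)] nonneg_if_pos_vec[OF pos(2)]] by simp
qed

text \<open>The infimum extends the criterion to matrices with zero entries. There both sides fail:
  \<open>J\<close> is identically infinite, and a rank-one nonnegative matrix without zero rows or
  columns is positive.\<close>

lemma Inf_J_eq_0_iff:
  fixes P :: "real ^ 't ^ 'r"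
  assumes nn: "\<And>r t. 0 \<le> P $ r $ t" and rows: "\<And>r. row r P \<noteq> 0" and cols: "\<And>t. column t P \<noteq> 0"
  shows "(INF (\<alpha>, \<beta>) \<in> {(\<alpha>, \<beta>). nonneg_vec \<alpha> \<and> nonneg_vec \<beta>}. J P \<alpha> \<beta>) = 0 \<longleftrightarrow> rank P = 1"
proof (cases "\<forall>r t. 0 < P $ r $ t")
  case True
  then have P: "0 < P $ r $ t" for r t by blast
  obtain \<alpha> \<beta> where s: "stationary_point P \<alpha> \<beta>"
    using iterates_converge[OF P iterates_pos[OF nn rows cols]] by blast
  then have pos: "pos_vec \<alpha>" "pos_vec \<beta>"
    by (auto simp: stationary_point_def)
  have m: "global_minimizer P \<alpha> \<beta>"
    using stationary_point_imp_global_minimizer[OF nn s] .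
  have "(INF (\<alpha>, \<beta>) \<in> {(\<alpha>, \<beta>). nonneg_vec \<alpha> \<and> nonneg_vec \<beta>}. J P \<alpha> \<beta>) = J P \<alpha> \<beta>"
  proof (rule antisym)
    show "(INF (\<alpha>, \<beta>) \<in> {(\<alpha>, \<beta>). nonneg_vec \<alpha> \<and> nonneg_vec \<beta>}. J P \<alpha> \<beta>) \<le> J P \<alpha> \<beta>"
      using m by (intro INF_lower2[of "(\<alpha>, \<beta>)"]) (auto simp: global_minimizer_def)
    show "J P \<alpha> \<beta> \<le> (INF (\<alpha>, \<beta>) \<in> {(\<alpha>, \<beta>). nonneg_vec \<alpha> \<and> nonneg_vec \<beta>}. J P \<alpha> \<beta>)"
      using m by (intro INF_greatest) (auto simp: global_minimizer_def)
  qed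
  then show ?thesis
    using global_minimizer_J_eq_0_iff[OF P pos m] by simp
next
  case False
  then have "J P \<alpha> \<beta> = \<infinity>" for \<alpha> \<beta>
    by (rule J_zero_entry[OF nn])
  then have "\<infinity> \<le> (INF (\<alpha>, \<beta>) \<in> {(\<alpha>, \<beta>). nonneg_vec \<alpha> \<and> nonneg_vec \<beta>}. J P \<alpha> \<beta>)"
    by (intro INF_greatest) auto
  then have "(INF (\<alpha>, \<beta>) \<in> {(\<alpha>, \<beta>). nonneg_vec \<alpha> \<and> nonneg_vec \<beta>}. J P \<alpha> \<beta>) \<noteq> 0"
    by force
  moreover have "rank P \<noteq> 1"
  proof
    assume "rank P = 1"
    then obtain \<alpha> \<beta> where "pos_vec \<alpha>" "pos_vec \<beta>" "P = outer \<alpha> \<beta>"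
      using rank_1_imp_outer[OF nn rows cols] by blast
    then show False
      using False by (auto simp: pos_vec_def)
  qed
  ultimately show ?thesis
    by simp
qed

text \<open>For fixed \<epsilon> the output is a finite iterate, so its convergence is stated as
  \<epsilon> tends to 0 from the right.\<close>

theorem mainTheorem1:
  fixes P :: "real ^ 't ^ 'r"
  assumes dims: "CARD('t) \<le> CARD('r)"
    and nonneg: "\<forall>r t. 0 \<le> P $ r $ t"
    and rows: "\<forall>r. row r P \<noteq> 0"
    and cols: "\<forall>t. column t P \<noteq> 0"
  shows
    \<comment> \<open>(i)\<close>
    "(\<forall>\<kappa>. pos_vec (alpha_seq P \<kappa>) \<and> pos_vec (beta_seq P \<kappa>)) \<and>
     ((\<forall>r t. 0 < P $ r $ t) \<longrightarrow> (\<forall>\<kappa>\<ge>1.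
       (\<forall>\<alpha>. pos_vec \<alpha> \<longrightarrow>
         (stationary_in_alpha P \<alpha> (beta_seq P (\<kappa> - 1)) \<longleftrightarrow> \<alpha> = alpha_seq P \<kappa>)) \<and>
       (\<forall>\<beta>. pos_vec \<beta> \<longrightarrow>
         (stationary_in_beta P (alpha_seq P \<kappa>) \<beta> \<longleftrightarrow> \<beta> = beta_seq P \<kappa>)))) \<and>
     (\<forall>\<kappa>\<ge>1.
       (\<forall>\<alpha>. pos_vec \<alpha> \<longrightarrow>
         (var_stationary_in_alpha P \<alpha> (beta_seq P (\<kappa> - 1)) \<longleftrightarrow> \<alpha> = alpha_seq P \<kappa>)) \<and>
       (\<forall>\<beta>. pos_vec \<beta> \<longrightarrow>
         (var_stationary_in_beta P (alpha_seq P \<kappa>) \<beta> \<longleftrightarrow> \<beta> = beta_seq P \<kappa>))) \<and>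
     (\<forall>\<kappa>\<ge>1.
       J P (alpha_seq P \<kappa>) (beta_seq P \<kappa>) \<le> J P (alpha_seq P \<kappa>) (beta_seq P (\<kappa> - 1)) \<and>
       J P (alpha_seq P \<kappa>) (beta_seq P (\<kappa> - 1)) \<le> J P (alpha_seq P (\<kappa> - 1)) (beta_seq P (\<kappa> - 1)) \<and>
       J_var P (alpha_seq P \<kappa>) (beta_seq P \<kappa>) \<le> J_var P (alpha_seq P \<kappa>) (beta_seq P (\<kappa> - 1)) \<and>
       J_var P (alpha_seq P \<kappa>) (beta_seq P (\<kappa> - 1))
         \<le> J_var P (alpha_seq P (\<kappa> - 1)) (beta_seq P (\<kappa> - 1))) \<and>
     decseq (J_seq P) \<and>
     (\<forall>rs ts \<epsilon>. \<forall>\<kappa>\<ge>1. enumerates rs \<longrightarrow> enumerates ts \<longrightarrow>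
       fst (iteration_prog rs ts P \<epsilon> (beta_seq P (\<kappa> - 1)) (J_seq P (\<kappa> - 1)))
         = (alpha_seq P \<kappa>, beta_seq P \<kappa>, J_seq P \<kappa>, stops_at P \<epsilon> \<kappa>) \<and>
       snd (iteration_prog rs ts P \<epsilon> (beta_seq P (\<kappa> - 1)) (J_seq P (\<kappa> - 1)))
         \<le> 20 * (CARD('r) * CARD('t))) \<and>
     \<comment> \<open>(ii)\<close>
     (\<forall>\<alpha> \<beta>. nonneg_vec \<alpha> \<longrightarrow> nonneg_vec \<beta> \<longrightarrow> 0 \<le> J P \<alpha> \<beta>) \<and>
     \<comment> \<open>(iii)\<close>
     ereal_convex (\<lambda>(x, y). J P (vec_exp x) (vec_exp y)) \<and>
     convex_on UNIV (\<lambda>(x, y). J_var P (vec_exp x) (vec_exp y)) \<and>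
     (\<forall>\<alpha> \<beta>. stationary_point P \<alpha> \<beta> \<longrightarrow> global_minimizer P \<alpha> \<beta>) \<and>
     (\<forall>\<alpha> \<beta>. pos_vec \<alpha> \<longrightarrow> pos_vec \<beta> \<longrightarrow>
       var_stationary_in_alpha P \<alpha> \<beta> \<longrightarrow> var_stationary_in_beta P \<alpha> \<beta> \<longrightarrow>
       (\<forall>\<alpha>' \<beta>'. pos_vec \<alpha>' \<longrightarrow> pos_vec \<beta>' \<longrightarrow> J_var P \<alpha> \<beta> \<le> J_var P \<alpha>' \<beta>')) \<and>
     ((INF (\<alpha>, \<beta>) \<in> {(\<alpha>, \<beta>). nonneg_vec \<alpha> \<and> nonneg_vec \<beta>}. J P \<alpha> \<beta>) = 0 \<longleftrightarrow> rank P = 1) \<and>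
     \<comment> \<open>(ii) and (iii), convergence: stationary points exist only where J is finite\<close>
     ((\<forall>r t. 0 < P $ r $ t) \<longrightarrow>
       (\<forall>\<epsilon>>0. \<exists>\<kappa>. stops_at P \<epsilon> \<kappa>) \<and>
       (\<exists>\<alpha>s \<beta>s.
         alpha_seq P \<longlonglongrightarrow> \<alpha>s \<and> beta_seq P \<longlonglongrightarrow> \<beta>s \<and>
         (algorithm_output P \<longlongrightarrow> outer \<alpha>s \<beta>s) (at_right 0) \<and>
         stationary_point P \<alpha>s \<beta>s \<and>
         global_minimizer P \<alpha>s \<beta>s \<and>
         rank (outer \<alpha>s \<beta>s) = 1 \<and>
         (\<forall>\<alpha> \<beta>. global_minimizer P \<alpha> \<beta> \<longrightarrow> outer \<alpha> \<beta> = outer \<alpha>s \<beta>s) \<and>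
         (J P \<alpha>s \<beta>s = 0 \<longleftrightarrow> rank P = 1)))"
proof -
  have nn: "0 \<le> P $ r $ t" and row: "row r P \<noteq> 0" and col: "column t P \<noteq> 0" for r t
    using nonneg rows cols by blast+
  have pos: "pos_vec (alpha_seq P \<kappa>) \<and> pos_vec (beta_seq P \<kappa>)" for \<kappa>
    by (rule iterates_pos[OF nn row col])
  have var_alpha: "var_stationary_in_alpha P \<alpha> (beta_seq P k) \<longleftrightarrow> \<alpha> = alpha_seq P (Suc k)"
    if "pos_vec \<alpha>" for \<alpha> k
    using var_stationary_in_alpha_iff[OF that, of "beta_seq P k" P] pos[of k] by (simp add: alpha_seq_Suc)
  have var_beta: "var_stationary_in_beta P (alpha_seq P k) \<beta> \<longleftrightarrow> \<beta> = beta_seq P k"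
    if "pos_vec \<beta>" for \<beta> k
    using var_stationary_in_beta_iff_update[OF _ that, of "alpha_seq P k" P] pos[of k] by (simp add: beta_seq_eq)
  \<comment> \<open>Writing \<kappa> as a successor removes the truncated subtraction in
    \<open>\<kappa> - 1\<close>.\<close>
  have index: "(\<forall>\<kappa>\<ge>1. Q \<kappa>) \<longleftrightarrow> (\<forall>k. Q (Suc k))" for Q :: "nat \<Rightarrow> bool"
    by (metis One_nat_def Suc_le_D Suc_le_mono le0)
  show ?thesis
    unfolding index diff_Suc_1
  proof (intro conjI)
    show "\<forall>\<kappa>. pos_vec (alpha_seq P \<kappa>) \<and> pos_vec (beta_seq P \<kappa>)"
      using pos by blast
    show "(\<forall>r t. 0 < P $ r $ t) \<longrightarrow> (\<forall>\<kappa>.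
       (\<forall>\<alpha>. pos_vec \<alpha> \<longrightarrow>
         (stationary_in_alpha P \<alpha> (beta_seq P \<kappa>) \<longleftrightarrow> \<alpha> = alpha_seq P (Suc \<kappa>))) \<and>
       (\<forall>\<beta>. pos_vec \<beta> \<longrightarrow>
         (stationary_in_beta P (alpha_seq P (Suc \<kappa>)) \<beta> \<longleftrightarrow> \<beta> = beta_seq P (Suc \<kappa>))))"
      using pos by (simp add: stationary_in_alpha_iff stationary_in_beta_iff var_alpha var_beta)
    show "\<forall>\<kappa>.
       (\<forall>\<alpha>. pos_vec \<alpha> \<longrightarrow>
         (var_stationary_in_alpha P \<alpha> (beta_seq P \<kappa>) \<longleftrightarrow> \<alpha> = alpha_seq P (Suc \<kappa>))) \<and>
       (\<forall>\<beta>. pos_vec \<beta> \<longrightarrow>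
         (var_stationary_in_beta P (alpha_seq P (Suc \<kappa>)) \<beta> \<longleftrightarrow> \<beta> = beta_seq P (Suc \<kappa>)))"
      by (simp add: var_alpha var_beta)
    show "\<forall>\<kappa>.
       J P (alpha_seq P (Suc \<kappa>)) (beta_seq P (Suc \<kappa>)) \<le> J P (alpha_seq P (Suc \<kappa>)) (beta_seq P \<kappa>) \<and>
       J P (alpha_seq P (Suc \<kappa>)) (beta_seq P \<kappa>) \<le> J P (alpha_seq P \<kappa>) (beta_seq P \<kappa>) \<and>
       J_var P (alpha_seq P (Suc \<kappa>)) (beta_seq P (Suc \<kappa>)) \<le> J_var P (alpha_seq P (Suc \<kappa>)) (beta_seq P \<kappa>) \<and>
       J_var P (alpha_seq P (Suc \<kappa>)) (beta_seq P \<kappa>) \<le> J_var P (alpha_seq P \<kappa>) (beta_seq P \<kappa>)"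
      using J_iterates_le[OF nn row col] J_var_iterates_le[OF nn row col] by blast
    show "decseq (J_seq P)"
      by (rule decseq_J_seq[OF nn row col])
    show "\<forall>rs ts \<epsilon> \<kappa>. enumerates rs \<longrightarrow> enumerates ts \<longrightarrow>
       fst (iteration_prog rs ts P \<epsilon> (beta_seq P \<kappa>) (J_seq P \<kappa>))
         = (alpha_seq P (Suc \<kappa>), beta_seq P (Suc \<kappa>), J_seq P (Suc \<kappa>), stops_at P \<epsilon> (Suc \<kappa>)) \<and>
       snd (iteration_prog rs ts P \<epsilon> (beta_seq P \<kappa>) (J_seq P \<kappa>)) \<le> 20 * (CARD('r) * CARD('t))"
      using fst_iteration_prog snd_iteration_prog_le by blast
    show "\<forall>\<alpha> \<beta>. nonneg_vec \<alpha> \<longrightarrow> nonneg_vec \<beta> \<longrightarrow> 0 \<le> J P \<alpha> \<beta>"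
      using J_nonneg[OF nn] by blast
    show "ereal_convex (\<lambda>(x, y). J P (vec_exp x) (vec_exp y))"
      by (rule J_vec_exp_ereal_convex[OF nn])
    show "convex_on UNIV (\<lambda>(x, y). J_var P (vec_exp x) (vec_exp y))"
      by (rule J_var_vec_exp_convex[OF nn])
    show "\<forall>\<alpha> \<beta>. stationary_point P \<alpha> \<beta> \<longrightarrow> global_minimizer P \<alpha> \<beta>"
      using stationary_point_imp_global_minimizer[OF nn] by blast
    show "\<forall>\<alpha> \<beta>. pos_vec \<alpha> \<longrightarrow> pos_vec \<beta> \<longrightarrow>
       var_stationary_in_alpha P \<alpha> \<beta> \<longrightarrow> var_stationary_in_beta P \<alpha> \<beta> \<longrightarrow>
       (\<forall>\<alpha>' \<beta>'. pos_vec \<alpha>' \<longrightarrow> pos_vec \<beta>' \<longrightarrow> J_var P \<alpha> \<beta> \<le> J_var P \<alpha>' \<beta>')"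
      using J_var_stationary_minimal(1)[OF nn] var_stationary_in_alpha_iff
        var_stationary_in_beta_iff_update by blast
    show "(INF (\<alpha>, \<beta>) \<in> {(\<alpha>, \<beta>). nonneg_vec \<alpha> \<and> nonneg_vec \<beta>}. J P \<alpha> \<beta>) = 0 \<longleftrightarrow> rank P = 1"
      by (rule Inf_J_eq_0_iff[OF nn row col])
    show "(\<forall>r t. 0 < P $ r $ t) \<longrightarrow>
       (\<forall>\<epsilon>>0. \<exists>\<kappa>. stops_at P \<epsilon> \<kappa>) \<and>
       (\<exists>\<alpha>s \<beta>s.
         alpha_seq P \<longlonglongrightarrow> \<alpha>s \<and> beta_seq P \<longlonglongrightarrow> \<beta>s \<and>
         (algorithm_output P \<longlongrightarrow> outer \<alpha>s \<beta>s) (at_right 0) \<and>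
         stationary_point P \<alpha>s \<beta>s \<and>
         global_minimizer P \<alpha>s \<beta>s \<and>
         rank (outer \<alpha>s \<beta>s) = 1 \<and>
         (\<forall>\<alpha> \<beta>. global_minimizer P \<alpha> \<beta> \<longrightarrow> outer \<alpha> \<beta> = outer \<alpha>s \<beta>s) \<and>
         (J P \<alpha>s \<beta>s = 0 \<longleftrightarrow> rank P = 1))"
    proof
      assume "\<forall>r t. 0 < P $ r $ t"
      then have P: "0 < P $ r $ t" for r t by blast
      obtain \<alpha>s \<beta>s where lim: "alpha_seq P \<longlonglongrightarrow> \<alpha>s" "beta_seq P \<longlonglongrightarrow> \<beta>s"
        and s: "stationary_point P \<alpha>s \<beta>s"
        using iterates_converge[OF P pos] .
      have pos_s: "pos_vec \<alpha>s" "pos_vec \<beta>s"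
        using s by (auto simp: stationary_point_def)
      note m = stationary_point_imp_global_minimizer[OF nn s]
      show "(\<forall>\<epsilon>>0. \<exists>\<kappa>. stops_at P \<epsilon> \<kappa>) \<and>
       (\<exists>\<alpha>s \<beta>s.
         alpha_seq P \<longlonglongrightarrow> \<alpha>s \<and> beta_seq P \<longlonglongrightarrow> \<beta>s \<and>
         (algorithm_output P \<longlongrightarrow> outer \<alpha>s \<beta>s) (at_right 0) \<and>
         stationary_point P \<alpha>s \<beta>s \<and>
         global_minimizer P \<alpha>s \<beta>s \<and>
         rank (outer \<alpha>s \<beta>s) = 1 \<and>
         (\<forall>\<alpha> \<beta>. global_minimizer P \<alpha> \<beta> \<longrightarrow> outer \<alpha> \<beta> = outer \<alpha>s \<beta>s) \<and>
         (J P \<alpha>s \<beta>s = 0 \<longleftrightarrow> rank P = 1))"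
        by (intro conjI allI impI exI[of _ \<alpha>s] exI[of _ \<beta>s])
          (rule stops_at_exists[OF P pos] lim algorithm_output_tendsto[OF P pos lim] s m
            rank_outer[OF pos_s] global_minimizer_outer_unique[OF P s]
            global_minimizer_J_eq_0_iff[OF P pos_s m]; assumption?)+
    qed
  qed
qed

end
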